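(* Let $Q=(B,D)$ be an invertible valued quiver on $n$ vertices. (1) For every vertex $k$, mutation in direction $k$ takes $B$-compatible elements to $\mu_kB$-compatible elements: if $X\in\mathcal{F}_{\Lambda_Q,q}$ is $B$-compatible, then $\mu_k(X)\in\mathcal{F}_{\Lambda_{\mu_kQ},q}$ is $\mu_kB$-compatible. (2) Let $\mathbb{F}$ be a finite field and $q=|\mathbb{F}|$. For $V\in rep\,Q$, the element $X_V\in\mathcal{T}_{\Lambda_Q,q}$ is $B$-compatible, with $F$-factor $$F_{X_V}=1+\sum_{\mathbf{e}\in\mathbb{Z}^n\setminus\{0\}}q^{\frac12\langle\mathbf{e},\mathbf{e}\rangle}|Gr_{\mathbf{e}}(V)|\,Z^{(\mathbf{e})}.$$
   Context: Notation: $[x]_+=\max(0,x)$; $\alpha_1,\dots,\alpha_n$ is the standard basis of $\mathbb{Z}^n$; $\mathbb{F}_k$ is the degree $k$ extension of $\mathbb{F}$ in a fixed algebraic closure. Valued quivers: an invertible valued quiver $Q=(B,D)$ is an invertible (over $\mathbb{Q}$) integer $n\times n$ matrix $B=(b_{ij})$ ($n$ even) together with $D=\mathrm{diag}(d_1,\dots,d_n)$, $d_i$ positive integers, such that $DB$ is skew-symmetric; it is regarded as the quiver with vertices $1,\dots,n$ with valuations $d_i$ and, whenever $b_{ij}>0$, $\gcd(|b_{ij}|,|b_{ji}|)$ arrows $i\to j$. $\mu_kQ=(\mu_kB,D)$, $\mu_kB=(b'_{ij})$ with $b'_{ij}=-b_{ij}$ if $i=k$ or $j=k$ and $b'_{ij}=b_{ij}+\mathrm{sgn}(b_{ik})[b_{ik}b_{kj}]_+$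 otherwise. Quantum tori: $\Lambda_Q=(\lambda_{ij}):=-DB^{-1}$ is skew-symmetric; $d$ is the least common multiple of the denominators of the $\lambda_{ij}$; $\mathcal{T}_{\Lambda_Q,q}=\mathbb{Z}[q^{\pm\frac1{2d}}]\langle X_1^{\pm1},\dots,X_n^{\pm1}\mid X_iX_j=q^{\lambda_{ij}}X_jX_i\rangle$, with skew field of fractions $\mathcal{F}_{\Lambda_Q,q}$, and $X^{(\mathbf{a})}:=q^{-\frac12\sum_{i<j}\lambda_{ij}a_ia_j}X_1^{a_1}\cdots X_n^{a_n}$. Mutation in direction $k$ is the isomorphism $\mu_k:\mathcal{F}_{\Lambda_Q,q}\to\mathcal{F}_{\Lambda_{\mu_kQ},q}$ with $\mu_k(X_i)=X_i$ for $i\ne k$ and $\mu_k(X_k)=X^{(-\alpha_k+\sum_\ell[b_{\ell k}]_+\alpha_\ell)}+X^{(-\alpha_k+\sum_\ell[-b_{\ell k}]_+\alpha_\ell)}$, the right-hand sides being formed in $\mathcal{T}_{\Lambda_{\mu_kQ},q}$. $B$-compatibility: let $\mathcal{T}_{DB,q}=\mathbb{Z}[q^{\pm\frac12}]\langle Z_1^{\pm1},\dots,Z_n^{\pm1}\mid Z_iZ_j=q^{d_ib_{ij}}Z_jZ_i\rangle$ with skew field of fractions $\mathcal{F}_{DB,q}$, and $Z^{(\mathbf{e})}:=q^{-\frac12\sum_{i<j}d_ib_{ij}e_ie_j}Z_1^{e_1}\cdots Z_n^{e_n}$. The assignment $Z_i\mapsto X^{(\mathbf{b}^i)}$, $\mathbf{b}^i$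 the $i$-th column of $B$, defines an embedding of skew fields $j:\mathcal{F}_{DB,q}\to\mathcal{F}_{\Lambda_Q,q}$. An element $X\in\mathcal{F}_{\Lambda_Q,q}$ is $B$-compatible if $X=j(F_X)X^{(\mathbf{g}_X)}$ for some $F_X\in\mathcal{F}_{DB,q}$ and $\mathbf{g}_X\in\mathbb{Z}^n$; such an $F_X$ is called an $F$-factor for $X$ (it depends on the choice of $\mathbf{g}_X$). $\mu_kB$-compatibility is defined in the same way with $\mu_kQ$ in place of $Q$. Valued representations: an object $V$ of $rep\,Q$ assigns a finite-dimensional $\mathbb{F}_{d_i}$-vector space $V_i$ to each vertex $i$ and an $\mathbb{F}_{\gcd(d_i,d_j)}$-linear map $V_i\to V_j$ to each arrow $i\to j$; $[V]=\sum_i(\dim_{\mathbb{F}_{d_i}}V_i)\alpha_i$. The Euler form on $\mathbb{Z}^n$ is the bilinear form with $\langle\alpha_i,\alpha_i\rangle=d_i$ and $\langle\alpha_i,\alpha_j\rangle=-\max(0,d_ib_{ij})$ for $i\ne j$; ${}^*\mathbf{e}:=(\frac1{d_1}\langle\alpha_1,\mathbf{e}\rangle,\dots,\frac1{d_n}\langle\alpha_n,\mathbf{e}\rangle)$. $Gr_{\mathbf{e}}(V)$ is the finite set of subobjects $W\subset V$ with $[W]=\mathbf{e}$. Define $$X_V=\sum_{\mathbf{e}}|\mathbb{F}|^{-\frac12\langle\mathbf{e},[V]-\mathbf{e}\rangle}|Gr_{\mathbf{e}}(V)|\,X^{(B\mathbf{e}-{}^*[V])}.$$ *)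

theory Defs
  imports
    "HOL-Analysis.Analysis"
    "HOL-Library.Poly_Mapping"
    "HOL-Algebra.Algebraic_Closure_Type"
    "HOL-Algebra.Generated_Rings"
    "HOL-Algebra.QuotRing"
    "Jordan_Normal_Form.Missing_VectorSpace"
begin

section \<open>Valued quivers\<close>

text \<open>The vertices \<open>1, \<dots>, n\<close> are the elements of a finite linearly ordered type \<open>'n\<close>. A valued
  quiver \<open>(B, D)\<close> is passed as two arguments: the matrix \<open>B\<close> and the diagonal \<open>D\<close> as a function.\<close>

definition rat_matrix :: "int^'n^'n \<Rightarrow> rat^'n^'n" where
  "rat_matrix B = map_matrix of_int B"

definition diag_matrix :: "('n::finite \<Rightarrow> nat) \<Rightarrow> rat^'n^'n" where
  "diag_matrix D = (\<chi> i j. if i = j then of_nat (D i) else 0)"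

definition invertible_valued_quiver :: "int^'n^'n \<Rightarrow> ('n::finite \<Rightarrow> nat) \<Rightarrow> bool" where
  "invertible_valued_quiver B D \<longleftrightarrow>
     even CARD('n) \<and> invertible (rat_matrix B) \<and> (\<forall>i. D i > 0) \<and>
     (\<forall>i j. int (D i) * B$i$j = - (int (D j) * B$j$i))"

definition mutate_matrix :: "'n \<Rightarrow> int^'n^'n \<Rightarrow> int^'n^('n::finite)" where
  "mutate_matrix k B = (\<chi> i j. if i = k \<or> j = k then - B$i$j
     else B$i$j + sgn (B$i$k) * max 0 (B$i$k * B$k$j))"

definition DB_matrix :: "int^'n^'n \<Rightarrow> ('n::finite \<Rightarrow> nat) \<Rightarrow> rat^'n^'n" where
  "DB_matrix B D = diag_matrix D ** rat_matrix B"

definition Lambda_matrix :: "int^'n^'n \<Rightarrow> ('n::finite \<Rightarrow> nat) \<Rightarrow> rat^'n^'n" where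
  "Lambda_matrix B D = - (diag_matrix D ** matrix_inv (rat_matrix B))"

section \<open>Quantum tori and their skew fields of fractions\<close>

subsection \<open>Free algebras\<close>

datatype 'a free_mon = Mon "'a list"

instantiation free_mon :: (type) monoid_add
begin

definition zero_free_mon :: "'a free_mon" where
  "zero_free_mon = Mon []"

fun plus_free_mon :: "'a free_mon \<Rightarrow> 'a free_mon \<Rightarrow> 'a free_mon" where
  "plus_free_mon (Mon xs) (Mon ys) = Mon (xs @ ys)"

instance
proof
  fix a b c :: "'a free_mon"
  show "a + b + c = a + (b + c)" by (cases a; cases b; cases c) simp
  show "0 + a = a" by (cases a) (simp add: zero_free_mon_def)
  show "a + 0 = a" by (cases a) (simp add: zero_free_mon_def)
qed

end

text \<open>The multiplication of \<open>'a free_mon \<Rightarrow>\<^sub>0 'k\<close> is convolution over concatenation of words, so this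
  is the free (noncommutative) algebra; its coefficients are restricted to a subring \<open>R\<close> of \<open>'k\<close>.\<close>

definition free_algebra :: "'k::field set \<Rightarrow> ('a free_mon \<Rightarrow>\<^sub>0 'k) ring" where
  "free_algebra R = ring_of_type_algebra\<lparr>carrier := {p. \<forall>w. Poly_Mapping.lookup p w \<in> R}\<rparr>"

subsection \<open>Quantum tori\<close>

text \<open>A choice of rational powers \<open>r \<mapsto> q\<^sup>r\<close> inside a field containing \<open>q\<close>. Taking \<open>q\<close>
  transcendental over the rationals gives the case where \<open>q\<close> is an indeterminate.\<close>

definition rational_powers :: "'k::field \<Rightarrow> (rat \<Rightarrow> 'k) \<Rightarrow> bool" where
  "rational_powers q qp \<longleftrightarrow> q \<noteq> 0 \<and> qp 1 = q \<and> (\<forall>r s. qp (r + s) = qp r * qp s)"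

definition common_denominator :: "rat^'n^'n \<Rightarrow> int" where
  "common_denominator L = Lcm {snd (quotient_of (L$i$j)) |i j. True}"

text \<open>The ring \<open>\<int>[q\<^sup>\<plusminus>\<^sup>1\<^sup>/\<^sup>(\<^sup>2\<^sup>d\<^sup>)]\<close> with \<open>d\<close> the common denominator of the entries of \<open>L\<close>. For integral
  \<open>L\<close>, such as \<open>DB\<close>, \<open>d = 1\<close> and this is \<open>\<int>[q\<^sup>\<plusminus>\<^sup>1\<^sup>/\<^sup>2]\<close>.\<close>

definition base_ring :: "(rat \<Rightarrow> 'k::field) \<Rightarrow> rat^'n^'n \<Rightarrow> 'k set" where
  "base_ring qp L = generate_ring ring_of_type_algebra
     {qp (1 / (2 * of_int (common_denominator L))), qp (- 1 / (2 * of_int (common_denominator L)))}"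

datatype 'n letter = Gen 'n | GenInv 'n

definition torus_relations ::
    "(rat \<Rightarrow> 'k::field) \<Rightarrow> rat^'n^'n \<Rightarrow> ('n::finite letter free_mon \<Rightarrow>\<^sub>0 'k) set" where
  "torus_relations qp L =
     {Poly_Mapping.single (Mon [Gen i, GenInv i]) 1 - 1 |i. True} \<union>
     {Poly_Mapping.single (Mon [GenInv i, Gen i]) 1 - 1 |i. True} \<union>
     {Poly_Mapping.single (Mon [Gen i, Gen j]) 1
        - Poly_Mapping.single (Mon [Gen j, Gen i]) (qp (L$i$j)) |i j. True}"

definition torus_ideal ::
    "(rat \<Rightarrow> 'k::field) \<Rightarrow> rat^'n^'n \<Rightarrow> ('n::finite letter free_mon \<Rightarrow>\<^sub>0 'k) set" where
  "torus_ideal qp L = genideal (free_algebra (base_ring qp L)) (torus_relations qp L)"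

definition quantum_torus ::
    "(rat \<Rightarrow> 'k::field) \<Rightarrow> rat^'n^'n \<Rightarrow> ('n::finite letter free_mon \<Rightarrow>\<^sub>0 'k) set ring" where
  "quantum_torus qp L = free_algebra (base_ring qp L) Quot torus_ideal qp L"

definition torus_class :: "(rat \<Rightarrow> 'k::field) \<Rightarrow> rat^'n^'n \<Rightarrow>
    ('n::finite letter free_mon \<Rightarrow>\<^sub>0 'k) \<Rightarrow> ('n letter free_mon \<Rightarrow>\<^sub>0 'k) set" where
  "torus_class qp L p = a_r_coset (free_algebra (base_ring qp L)) (torus_ideal qp L) p"

subsection \<open>Skew fields of fractions\<close>

text \<open>The division ring \<open>'f\<close> is, via the embedding \<open>\<iota>\<close>, a skew field of fractions of \<open>T\<close>. Such a pair
  is unique up to unique isomorphism, so it is left arbitrary.\<close>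

definition is_skew_fraction_field ::
    "('t, 'm) ring_scheme \<Rightarrow> ('t \<Rightarrow> 'f::division_ring) \<Rightarrow> bool" where
  "is_skew_fraction_field T \<iota> \<longleftrightarrow>
     \<iota> \<in> ring_hom T ring_of_type_algebra \<and> inj_on \<iota> (carrier T) \<and>
     (\<forall>z. \<exists>a\<in>carrier T. \<exists>b\<in>carrier T. b \<noteq> \<zero>\<^bsub>T\<^esub> \<and> z = \<iota> a * inverse (\<iota> b))"

type_synonym ('n, 'k, 'f) torus_map = "('n letter free_mon \<Rightarrow>\<^sub>0 'k) set \<Rightarrow> 'f"

definition torus_scalar :: "(rat \<Rightarrow> 'k::field) \<Rightarrow> rat^'n^'n \<Rightarrow>
    ('n::finite, 'k, 'f) torus_map \<Rightarrow> 'k \<Rightarrow> 'f" where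
  "torus_scalar qp L \<iota> r = \<iota> (torus_class qp L (Poly_Mapping.single 0 r))"

definition torus_gen :: "(rat \<Rightarrow> 'k::field) \<Rightarrow> rat^'n^'n \<Rightarrow>
    ('n::finite, 'k, 'f) torus_map \<Rightarrow> 'n \<Rightarrow> 'f" where
  "torus_gen qp L \<iota> i = \<iota> (torus_class qp L (Poly_Mapping.single (Mon [Gen i]) 1))"

text \<open>The normalised monomial \<open>X\<^sup>(\<^sup>a\<^sup>)\<close>; for \<open>L = DB\<close> it is \<open>Z\<^sup>(\<^sup>a\<^sup>)\<close>.\<close>

definition torus_monomial ::
    "(rat \<Rightarrow> 'k::field) \<Rightarrow> rat^'n::{finite,linorder}^'n::{finite,linorder} \<Rightarrow>
    ('n, 'k, 'f::division_ring) torus_map \<Rightarrow> int^'n::{finite,linorder} \<Rightarrow> 'f" where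
  "torus_monomial qp L \<iota> a =
     torus_scalar qp L \<iota> (qp (- (1/2) * (\<Sum>j\<in>UNIV. \<Sum>i\<in>{..<j}. L$i$j * of_int (a$i) * of_int (a$j))))
     * prod_list (map (\<lambda>i. torus_gen qp L \<iota> i powi (a$i)) (sorted_list_of_set UNIV))"

subsection \<open>Mutation\<close>

definition mutation_exponent :: "(int \<Rightarrow> int) \<Rightarrow> int^'n^'n \<Rightarrow> 'n \<Rightarrow> int^('n::finite)" where
  "mutation_exponent s B k = - axis k 1 + (\<Sum>l\<in>UNIV. max 0 (s (B$l$k)) *s axis l 1)"

definition is_mutation ::
    "(rat \<Rightarrow> 'k::field) \<Rightarrow> int^'n::{finite,linorder}^'n::{finite,linorder} \<Rightarrow>
    ('n \<Rightarrow> nat) \<Rightarrow> 'n \<Rightarrow>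
    ('n, 'k, 'f::division_ring) torus_map \<Rightarrow>
    ('n, 'k, 'f'::division_ring) torus_map \<Rightarrow> ('f \<Rightarrow> 'f') \<Rightarrow> bool" where
  "is_mutation qp B D k \<iota> \<iota>' \<mu> \<longleftrightarrow>
     (let L = Lambda_matrix B D; L' = Lambda_matrix (mutate_matrix k B) D in
      \<mu> \<in> ring_iso ring_of_type_algebra ring_of_type_algebra \<and>
      (\<forall>r\<in>base_ring qp L. \<mu> (torus_scalar qp L \<iota> r) = torus_scalar qp L' \<iota>' r) \<and>
      (\<forall>i. i \<noteq> k \<longrightarrow> \<mu> (torus_gen qp L \<iota> i) = torus_gen qp L' \<iota>' i) \<and>
      \<mu> (torus_gen qp L \<iota> k) =
        torus_monomial qp L' \<iota>' (mutation_exponent (\<lambda>b. b) B k)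
        + torus_monomial qp L' \<iota>' (mutation_exponent uminus B k))"

subsection \<open>Compatibility with the exchange matrix\<close>

definition is_DB_embedding ::
    "(rat \<Rightarrow> 'k::field) \<Rightarrow> int^'n::{finite,linorder}^'n::{finite,linorder} \<Rightarrow>
    ('n \<Rightarrow> nat) \<Rightarrow>
    ('n, 'k, 'g::division_ring) torus_map \<Rightarrow>
    ('n, 'k, 'f::division_ring) torus_map \<Rightarrow> ('g \<Rightarrow> 'f) \<Rightarrow> bool" where
  "is_DB_embedding qp B D \<iota>Z \<iota> j \<longleftrightarrow>
     j \<in> ring_hom ring_of_type_algebra ring_of_type_algebra \<and> inj j \<and>
     (\<forall>r\<in>base_ring qp (DB_matrix B D).
        j (torus_scalar qp (DB_matrix B D) \<iota>Z r) = torus_scalar qp (Lambda_matrix B D) \<iota> r) \<and>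
     (\<forall>i. j (torus_gen qp (DB_matrix B D) \<iota>Z i)
        = torus_monomial qp (Lambda_matrix B D) \<iota> (column i B))"

definition is_F_factor ::
    "(rat \<Rightarrow> 'k::field) \<Rightarrow> int^'n::{finite,linorder}^'n::{finite,linorder} \<Rightarrow>
    ('n \<Rightarrow> nat) \<Rightarrow>
    ('n, 'k, 'f::division_ring) torus_map \<Rightarrow> ('g \<Rightarrow> 'f) \<Rightarrow> 'g \<Rightarrow> 'f \<Rightarrow> bool" where
  "is_F_factor qp B D \<iota> j F x \<longleftrightarrow>
     (\<exists>g. x = j F * torus_monomial qp (Lambda_matrix B D) \<iota> g)"

definition B_compatible ::
    "(rat \<Rightarrow> 'k::field) \<Rightarrow> int^'n::{finite,linorder}^'n::{finite,linorder} \<Rightarrow>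
    ('n \<Rightarrow> nat) \<Rightarrow>
    ('n, 'k, 'f::division_ring) torus_map \<Rightarrow> ('g \<Rightarrow> 'f) \<Rightarrow> 'f \<Rightarrow> bool" where
  "B_compatible qp B D \<iota> j x \<longleftrightarrow> (\<exists>F. is_F_factor qp B D \<iota> j F x)"

section \<open>Valued representations\<close>

text \<open>\<open>K\<close> is the ground field inside an algebraic closure \<open>L\<close>.\<close>

definition degree_extension :: "'c ring \<Rightarrow> 'c set \<Rightarrow> nat \<Rightarrow> 'c ring" where
  "degree_extension L K m =
     L\<lparr>carrier := (THE E. subfield E L \<and> K \<subseteq> E \<and> ring.dimension L m K E)\<rparr>"

text \<open>The arrows \<open>i \<rightarrow> j\<close> are numbered by \<open>m < gcd(|b\<^sub>i\<^sub>j|, |b\<^sub>j\<^sub>i|)\<close>, provided \<open>b\<^sub>i\<^sub>j > 0\<close>.\<close>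

definition is_arrow :: "int^'n^'n \<Rightarrow> 'n::finite \<Rightarrow> 'n \<Rightarrow> nat \<Rightarrow> bool" where
  "is_arrow B i j m \<longleftrightarrow> B$i$j > 0 \<and> int m < gcd \<bar>B$i$j\<bar> \<bar>B$j$i\<bar>"

definition is_valued_rep :: "int^'n^'n \<Rightarrow> ('n::finite \<Rightarrow> nat) \<Rightarrow> 'c ring \<Rightarrow> 'c set \<Rightarrow>
    ('n \<Rightarrow> ('c, 'v) module) \<Rightarrow> ('n \<Rightarrow> 'n \<Rightarrow> nat \<Rightarrow> 'v \<Rightarrow> 'v) \<Rightarrow> bool" where
  "is_valued_rep B D L K V \<phi> \<longleftrightarrow>
     (\<forall>i. vectorspace (degree_extension L K (D i)) (V i) \<and>
          vectorspace.fin_dim (degree_extension L K (D i)) (V i)) \<and>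
     (\<forall>i j m. is_arrow B i j m \<longrightarrow>
          linear_map (degree_extension L K (gcd (D i) (D j))) (V i) (V j) (\<phi> i j m))"

definition dim_vector :: "('n::finite \<Rightarrow> nat) \<Rightarrow> 'c ring \<Rightarrow> 'c set \<Rightarrow>
    ('n \<Rightarrow> ('c, 'v) module) \<Rightarrow> int^'n" where
  "dim_vector D L K V = (\<chi> i. int (vectorspace.dim (degree_extension L K (D i)) (V i)))"

definition quiver_grassmannian :: "int^'n^'n \<Rightarrow> ('n::finite \<Rightarrow> nat) \<Rightarrow> 'c ring \<Rightarrow> 'c set \<Rightarrow>
    ('n \<Rightarrow> ('c, 'v) module) \<Rightarrow> ('n \<Rightarrow> 'n \<Rightarrow> nat \<Rightarrow> 'v \<Rightarrow> 'v) \<Rightarrow> int^'n \<Rightarrow> ('n \<Rightarrow> 'v set) set" where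
  "quiver_grassmannian B D L K V \<phi> e =
     {W. (\<forall>i. VectorSpace.subspace (degree_extension L K (D i)) (W i) (V i)) \<and>
         (\<forall>i j m. is_arrow B i j m \<longrightarrow> \<phi> i j m ` W i \<subseteq> W j) \<and>
         dim_vector D L K (\<lambda>i. (V i)\<lparr>carrier := W i\<rparr>) = e}"

definition euler_form :: "int^'n^'n \<Rightarrow> ('n::finite \<Rightarrow> nat) \<Rightarrow> int^'n \<Rightarrow> int^'n \<Rightarrow> int" where
  "euler_form B D a b = (\<Sum>i\<in>UNIV. \<Sum>j\<in>UNIV. a$i * b$j *
     (if i = j then int (D i) else - max 0 (int (D i) * B$i$j)))"

text \<open>The division is exact.\<close>

definition left_dual :: "int^'n^'n \<Rightarrow> ('n::finite \<Rightarrow> nat) \<Rightarrow> int^'n \<Rightarrow> int^'n" where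
  "left_dual B D e = (\<chi> i. euler_form B D (axis i 1) e div int (D i))"

definition real_rational_power :: "real \<Rightarrow> rat \<Rightarrow> real" where
  "real_rational_power q r = q powr of_rat r"

text \<open>Sums over infinite sets are \<open>0\<close> in HOL, so the sums over \<open>e\<close> below are restricted to the
  finitely many dimension vectors of subrepresentations.\<close>

definition cluster_character ::
    "int^'n::{finite,linorder}^'n::{finite,linorder} \<Rightarrow>
    ('n \<Rightarrow> nat) \<Rightarrow> 'c ring \<Rightarrow> 'c set \<Rightarrow>
    ('n \<Rightarrow> ('c, 'v) module) \<Rightarrow> ('n \<Rightarrow> 'n \<Rightarrow> nat \<Rightarrow> 'v \<Rightarrow> 'v) \<Rightarrow>
    ('n, real, 'f::division_ring) torus_map \<Rightarrow> 'f" where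
  "cluster_character B D L K V \<phi> \<iota> =
     (let qp = real_rational_power (real (card K)); v = dim_vector D L K V in
      \<Sum>e | quiver_grassmannian B D L K V \<phi> e \<noteq> {}.
        torus_scalar qp (Lambda_matrix B D) \<iota> (qp (- (1/2) * of_int (euler_form B D e (v - e))))
        * of_nat (card (quiver_grassmannian B D L K V \<phi> e))
        * torus_monomial qp (Lambda_matrix B D) \<iota> (B *v e - left_dual B D v))"

definition F_polynomial ::
    "int^'n::{finite,linorder}^'n::{finite,linorder} \<Rightarrow>
    ('n \<Rightarrow> nat) \<Rightarrow> 'c ring \<Rightarrow> 'c set \<Rightarrow>
    ('n \<Rightarrow> ('c, 'v) module) \<Rightarrow> ('n \<Rightarrow> 'n \<Rightarrow> nat \<Rightarrow> 'v \<Rightarrow> 'v) \<Rightarrow>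
    ('n, real, 'g::division_ring) torus_map \<Rightarrow> 'g" where
  "F_polynomial B D L K V \<phi> \<iota>Z =
     (let qp = real_rational_power (real (card K)) in
      1 + (\<Sum>e | e \<noteq> 0 \<and> quiver_grassmannian B D L K V \<phi> e \<noteq> {}.
        torus_scalar qp (DB_matrix B D) \<iota>Z (qp (1/2 * of_int (euler_form B D e e)))
        * of_nat (card (quiver_grassmannian B D L K V \<phi> e))
        * torus_monomial qp (DB_matrix B D) \<iota>Z e))"

end

theory Submission
  imports Defs
begin

text \<open>Write \<open>\<Lambda>(a, b)\<close> for the bilinear form of the matrix \<open>\<Lambda> = - D B\<^sup>-\<^sup>1\<close> on \<open>\<int>\<^sup>n\<close>. Normalised
  monomials satisfy \<open>X\<^sup>(\<^sup>a\<^sup>) X\<^sup>(\<^sup>b\<^sup>) = q^(\<Lambda>(a, b) / 2) X\<^sup>(\<^sup>a\<^sup>+\<^sup>b\<^sup>)\<close> (\<open>monomial_mult\<close>). Everything rests on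
  the identity \<open>\<Lambda> B = - D\<close>, which says \<open>\<Lambda>(x, B e) = - \<Sum>\<^sub>l d\<^sub>l x\<^sub>l e\<^sub>l\<close>
  (\<open>lattice_form_matrix_vector_mult\<close>). Its first consequence is \<open>j(Z\<^sup>(\<^sup>e\<^sup>)) = X\<^sup>(\<^sup>B\<^sup>e\<^sup>)\<close>, since \<open>\<Lambda>\<close> pulls back
  along \<open>B\<close> to \<open>DB\<close>. The second is that \<open>X\<^sup>(\<^sup>g\<^sup>)\<close> commutes with every \<open>X\<^sup>(\<^sup>B\<^sup>e\<^sup>)\<close> up to an \<^emph>\<open>integral\<close> power
  of \<open>q\<close>, so conjugation by \<open>X\<^sup>(\<^sup>g\<^sup>)\<close> maps the image of \<open>j\<close> into itself (\<open>monomial_normalises\<close>). Integrality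
  matters, because the image of \<open>j\<close> need not contain the fractional powers of \<open>q\<close>.

  \<^bold>\<open>Mutation.\<close> Let \<open>E\<close> be the linear involution of \<open>\<int>\<^sup>n\<close> that fixes \<open>\<alpha>\<^sub>i\<close> for \<open>i \<noteq> k\<close> and sends \<open>\<alpha>\<^sub>k\<close> to
  \<open>- \<alpha>\<^sub>k + \<Sum>\<^sub>l [- b\<^sub>l\<^sub>k]\<^sub>+ \<alpha>\<^sub>l\<close>, and write primes for the data of the mutated quiver. There is a companion
  involution \<open>F\<close> with \<open>E B = B' F\<close>, and it follows that \<open>\<Lambda>'(E g, E h) = \<Lambda>(g, h)\<close>
  (\<open>lattice_form_mutate_exponent\<close>). The claim is that \<open>\<mu>(X\<^sup>(\<^sup>g\<^sup>))\<close> is \<open>X'\<^sup>(\<^sup>E\<^sup>g\<^sup>)\<close> up to a left factor from the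
  image of \<open>j'\<close> (\<open>mu_monomial\<close>). It holds for the basis vectors: the two exponents in \<open>\<mu>(X\<^sub>k)\<close> differ by
  a column of \<open>B'\<close>, so \<open>\<mu>(X\<^sub>k)\<close> is a binomial in \<open>Z'\<^sub>k\<^sup>-\<^sup>1\<close> times \<open>X'\<close> to the power \<open>E \<alpha>\<^sub>k\<close>. It passes to sums and negatives of
  exponents because both sides have the same cocycle and the image of \<open>j'\<close> is normalised by monomials.
  For \<open>g = B \<alpha>\<^sub>i\<close> the monomial \<open>X'\<close> to the power \<open>E g = B' F \<alpha>\<^sub>i\<close> lies itself in the image of \<open>j'\<close>. Hence \<open>\<mu>\<close>
  maps the images of the generators \<open>Z\<^sub>i\<close>, and so the whole image of \<open>j\<close>, into the image of \<open>j'\<close>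
  (\<open>mu_range_j\<close>). Applying \<open>\<mu>\<close> to \<open>j(F) X\<^sup>(\<^sup>g\<^sup>)\<close> gives the first part.

  \<^bold>\<open>Cluster characters.\<close> With \<open>v = [V]\<close>, the identity for \<open>\<Lambda>(x, B e)\<close> gives \<open>\<Lambda>(B e, \<^sup>*v) = \<langle>e, v\<rangle>\<close>, so that
  \<open>X^(B e - \<^sup>*v) = q^(\<langle>e, v\<rangle> / 2) X^(B e) X^(- \<^sup>*v)\<close>. Together with the coefficient \<open>q^(- \<langle>e, v - e\<rangle> / 2)\<close>
  this leaves \<open>q^(\<langle>e, e\<rangle> / 2)\<close>, and the factor \<open>X^(- \<^sup>*v)\<close> comes out of the sum. The constant term of the
  \<open>F\<close>-factor is \<open>1\<close> because the zero subobject is the only one of dimension vector \<open>0\<close>.\<close>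

(* From here on, $ denotes components of vectors only. *)
no_notation fps_nth (infixl "$" 75)

section \<open>Type-class rings as ring records\<close>

lemma ring_of_type_algebra_simps [simp]:
  "carrier ring_of_type_algebra = UNIV"
  "monoid.mult ring_of_type_algebra x y = x * y"
  "monoid.one ring_of_type_algebra = 1"
  "ring.zero ring_of_type_algebra = 0"
  "ring.add ring_of_type_algebra x y = x + y"
  by (simp_all add: ring_of_type_algebra_def)

lemma ring_ring_of_type_algebra: "ring (ring_of_type_algebra :: 'a::ring_1 ring)"
proof (rule ringI)
  have "\<exists>y\<in>UNIV. y + x = 0" for x :: 'a
    by (rule bexI[of _ "- x"]) simp_all
  then show "abelian_group (ring_of_type_algebra :: 'a ring)"
    by (intro abelian_groupI) (simp_all add: add.assoc add.commute)
  show "monoid (ring_of_type_algebra :: 'a ring)"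
    by (rule monoidI) (simp_all add: mult.assoc)
qed (simp_all add: algebra_simps)

lemma a_inv_ring_of_type_algebra [simp]:
  "a_inv ring_of_type_algebra (x :: 'a::ring_1) = - x"
proof -
  interpret ring "ring_of_type_algebra :: 'a ring" by (rule ring_ring_of_type_algebra)
  show ?thesis by (rule minus_equality) simp_all
qed

lemma generate_ring_of_type_algebra_subring:
  "subring (generate_ring ring_of_type_algebra H) (ring_of_type_algebra :: 'a::ring_1 ring)"
  by (rule ring.generate_ring_is_subring[OF ring_ring_of_type_algebra]) simp

section \<open>Exponents and scalars\<close>

definition lattice_form :: "rat^'n^'n \<Rightarrow> int^'n \<Rightarrow> int^'n \<Rightarrow> rat" where
  "lattice_form M a b = (\<Sum>i\<in>UNIV. \<Sum>j\<in>UNIV. of_int (a$i) * M$i$j * of_int (b$j))"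

lemma lattice_form_add_left: "lattice_form M (a + a') b = lattice_form M a b + lattice_form M a' b"
  by (simp add: lattice_form_def algebra_simps sum.distrib)

lemma lattice_form_add_right: "lattice_form M a (b + b') = lattice_form M a b + lattice_form M a b'"
  by (simp add: lattice_form_def algebra_simps sum.distrib)

lemma lattice_form_minus_left: "lattice_form M (- a) b = - lattice_form M a b"
  by (simp add: lattice_form_def sum_negf)

lemma lattice_form_minus_right: "lattice_form M a (- b) = - lattice_form M a b"
  by (simp add: lattice_form_def sum_negf)

lemma lattice_form_axis: "lattice_form M (axis i 1) (axis j 1) = M$i$j"
proof -
  have "lattice_form M (axis i 1) (axis j 1) = (\<Sum>i'\<in>UNIV. \<Sum>j'\<in>UNIV. if j' = j then (if i' = i then M$i$j else 0) else 0)"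
    unfolding lattice_form_def by (intro sum.cong refl) (auto simp: axis_def)
  then show ?thesis by simp
qed

lemma lattice_form_swap:
  assumes "\<And>i j. M$i$j = - M$j$i"
  shows "lattice_form M a b = - lattice_form M b a"
proof -
  have "of_int (a$j) * M$j$i * of_int (b$i) = - (of_int (b$i) * M$i$j * of_int (a$j))" for i j
    using assms[of j i] by simp
  then show ?thesis
    unfolding lattice_form_def by (subst sum.swap) (simp add: sum_negf)
qed

lemma lattice_form_self:
  assumes "\<And>i j. M$i$j = - M$j$i"
  shows "lattice_form M a a = 0"
  using lattice_form_swap[OF assms, of a a] by linarith

text \<open>Both sides of an identity between twisted-multiplicative families indexed by \<open>\<int>\<^sup>n\<close> agree as soon as
  they agree on the basis; this is the form in which \<open>\<int>\<^sup>n\<close> being generated by its basis is used.\<close>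

lemma vec_int_induct [case_names axis add minus]:
  fixes P :: "int^'n::finite \<Rightarrow> bool"
  assumes ax: "\<And>i. P (axis i 1)" and add: "\<And>a b. P a \<Longrightarrow> P b \<Longrightarrow> P (a + b)"
    and minus: "\<And>a. P a \<Longrightarrow> P (- a)"
  shows "P a"
proof -
  have z: "P 0" using add[OF ax minus[OF ax]] by (metis add.right_inverse)
  have n: "P (int m *s axis i 1)" for m i
  proof (induction m)
    case (Suc m)
    have "int (Suc m) *s axis i 1 = int m *s axis i 1 + (axis i 1 :: int^'n)"
      by (simp add: vec_eq_iff axis_def)
    then show ?case using add[OF Suc ax] by (simp only:)
  qed (use z in simp)
  have i: "P (c *s axis i 1)" for c i
  proof (cases "c \<ge> 0")
    case True
    then show ?thesis using n[of "nat c" i] by simp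
  next
    case False
    have "c *s axis i 1 = - (int (nat (- c)) *s axis i (1::int))"
      using False by (simp add: vec_eq_iff)
    then show ?thesis using minus[OF n] by (simp only:)
  qed
  have "P (\<Sum>i\<in>S. a$i *s axis i 1)" if "finite S" for S
    using that by (induction S) (auto simp: z intro!: add i)
  from this[of UNIV] show ?thesis
    by (metis basis_expansion finite_class.finite_UNIV)
qed

text \<open>The exponents \<open>r\<close> for which \<open>q\<^sup>r\<close> is available in the coefficient ring \<open>\<int>[q\<^sup>\<plusminus>\<^sup>1\<^sup>/\<^sup>(\<^sup>2\<^sup>d\<^sup>)]\<close>. Other
  values of \<open>qp\<close> need not lie in that ring and then represent no scalar of the quantum torus, so every
  exponent below has to be located in this group.\<close>

definition half_exponents :: "rat^'n^'n \<Rightarrow> rat set" where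
  "half_exponents M = range (\<lambda>m. of_int m / (2 * of_int (common_denominator M)))"

lemma common_denominator_pos: "common_denominator (M :: rat^'n::finite^'n) > 0"
proof -
  let ?S = "{snd (quotient_of (M$i$j)) |i j. True}"
  have "?S = (\<lambda>(i,j). snd (quotient_of (M$i$j))) ` UNIV" by auto
  then have "finite ?S" by simp
  moreover have "0 \<notin> ?S" by clarify (metis quotient_of_denom_pos' less_irrefl)
  ultimately have "Lcm ?S \<noteq> 0" by (simp add: Lcm_0_iff)
  moreover have "Lcm ?S \<ge> 0" by (metis abs_ge_zero Lcm_int_greater_eq_0)
  ultimately show ?thesis unfolding common_denominator_def by linarith
qed

lemma half_exponents_add:
  assumes "r \<in> half_exponents M" "s \<in> half_exponents M"
  shows "r + s \<in> half_exponents M"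
proof -
  let ?d = "2 * of_int (common_denominator M) :: rat"
  obtain m k where "r = of_int m / ?d" "s = of_int k / ?d"
    using assms unfolding half_exponents_def by blast
  then have "r + s = of_int (m + k) / ?d" by (simp add: add_divide_distrib)
  then show ?thesis unfolding half_exponents_def by blast
qed

lemma half_exponents_mult_int:
  assumes "r \<in> half_exponents M"
  shows "of_int k * r \<in> half_exponents M"
proof -
  let ?d = "2 * of_int (common_denominator M) :: rat"
  obtain m where "r = of_int m / ?d"
    using assms unfolding half_exponents_def by blast
  then have "of_int k * r = of_int (k * m) / ?d" by simp
  then show ?thesis unfolding half_exponents_def by blast
qed

lemma half_exponents_minus: "r \<in> half_exponents M \<Longrightarrow> - r \<in> half_exponents M"
  using half_exponents_mult_int[of r M "-1"] by simp

lemma half_exponents_half_int: "of_int m / 2 \<in> half_exponents (M :: rat^'n::finite^'n)"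
proof -
  have "(of_int m / 2 :: rat) = of_int (m * common_denominator M) / (2 * of_int (common_denominator M))"
    using common_denominator_pos[of M] by simp
  then show ?thesis unfolding half_exponents_def by blast
qed

lemma half_exponents_half_entry: "M$i$j / 2 \<in> half_exponents (M :: rat^'n::finite^'n)"
proof -
  obtain a b where ab: "quotient_of (M$i$j) = (a, b)" by force
  have "b = snd (quotient_of (M$i$j))" by (simp add: ab)
  then have "b dvd common_denominator M"
    unfolding common_denominator_def by (intro dvd_Lcm) blast
  then obtain c where c: "common_denominator M = b * c" by blast
  have "c \<noteq> 0" "b \<noteq> 0" using common_denominator_pos[of M] c by auto
  then have "M$i$j / 2 = of_int (a * c) / (2 * of_int (common_denominator M))"
    using quotient_of_div[OF ab] c by simp
  then show ?thesis unfolding half_exponents_def by blast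
qed

lemma half_exponents_zero: "0 \<in> half_exponents (M :: rat^'n::finite^'n)"
  using half_exponents_half_int[of 0] by simp

lemma half_exponents_sum: "(\<And>x. x \<in> S \<Longrightarrow> f x \<in> half_exponents M) \<Longrightarrow> sum f S \<in> half_exponents (M :: rat^'n::finite^'n)"
  by (induction S rule: infinite_finite_induct) (auto simp: half_exponents_zero intro: half_exponents_add)

lemma half_exponents_half_lattice_form: "lattice_form M a b / 2 \<in> half_exponents (M :: rat^'n::finite^'n)"
proof -
  have eq: "of_int (a$i) * M$i$j * of_int (b$j) / 2 = of_int (a$i * b$j) * (M$i$j / 2)" for i j by simp
  show ?thesis
    unfolding lattice_form_def sum_divide_distrib eq
    by (intro half_exponents_sum half_exponents_mult_int half_exponents_half_entry)
qed

lemma half_exponents_lattice_form: "lattice_form M a b \<in> half_exponents (M :: rat^'n::finite^'n)"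
  using half_exponents_mult_int[OF half_exponents_half_lattice_form[of M a b], of 2] by simp

lemma half_exponents_entry: "M$i$j \<in> half_exponents (M :: rat^'n::finite^'n)"
  using half_exponents_mult_int[OF half_exponents_half_entry[of M i j], of 2] by simp

lemma half_exponents_int: "of_int m \<in> half_exponents (M :: rat^'n::finite^'n)"
  using half_exponents_half_int[of "2*m"] by simp

lemma rational_powers_zero: "rational_powers q qp \<Longrightarrow> qp 0 = 1"
  unfolding rational_powers_def by (metis add.right_neutral mult_cancel_left1)

lemma rational_powers_of_nat: "rational_powers q qp \<Longrightarrow> qp (of_nat m * r) = qp r ^ m"
  by (induction m) (auto simp: rational_powers_zero rational_powers_def algebra_simps)

lemma
  shows base_ring_one: "1 \<in> base_ring qp M"
    and base_ring_zero: "0 \<in> base_ring qp M"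
    and base_ring_minus: "r \<in> base_ring qp M \<Longrightarrow> - r \<in> base_ring qp M"
    and base_ring_add: "r \<in> base_ring qp M \<Longrightarrow> s \<in> base_ring qp M \<Longrightarrow> r + s \<in> base_ring qp M"
    and base_ring_mult: "r \<in> base_ring qp M \<Longrightarrow> s \<in> base_ring qp M \<Longrightarrow> r * s \<in> base_ring qp M"
proof -
  interpret S: subring "base_ring qp M" ring_of_type_algebra
    unfolding base_ring_def by (rule generate_ring_of_type_algebra_subring)
  show "1 \<in> base_ring qp M" "0 \<in> base_ring qp M"
    using subringE(2,3)[OF S.subring_axioms] by simp_all
  show "r \<in> base_ring qp M \<Longrightarrow> - r \<in> base_ring qp M"
    using subringE(5)[OF S.subring_axioms, of r] by simp
  show "r \<in> base_ring qp M \<Longrightarrow> s \<in> base_ring qp M \<Longrightarrow> r + s \<in> base_ring qp M"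
    using subringE(7)[OF S.subring_axioms, of r s] by simp
  show "r \<in> base_ring qp M \<Longrightarrow> s \<in> base_ring qp M \<Longrightarrow> r * s \<in> base_ring qp M"
    using subringE(6)[OF S.subring_axioms, of r s] by simp
qed

lemma base_ring_sum: "(\<And>x. x \<in> S \<Longrightarrow> f x \<in> base_ring qp M) \<Longrightarrow> sum f S \<in> base_ring qp M"
  by (induction S rule: infinite_finite_induct) (auto simp: base_ring_zero intro: base_ring_add)

lemma base_ring_power: "r \<in> base_ring qp M \<Longrightarrow> r ^ m \<in> base_ring qp M"
  by (induction m) (auto simp: base_ring_one intro: base_ring_mult)

lemma base_ring_exponent:
  assumes q: "rational_powers q qp" and r: "r \<in> half_exponents M"
  shows "qp r \<in> base_ring qp M"
proof -
  define e where "e = 1 / (2 * of_int (common_denominator M) :: rat)"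
  obtain m where m: "r = of_int m * e"
    using r unfolding half_exponents_def e_def by auto
  have g: "qp e \<in> base_ring qp M" "qp (- e) \<in> base_ring qp M"
    unfolding base_ring_def e_def by (auto intro: generate_ring.incl)
  show ?thesis
  proof (cases "m \<ge> 0")
    case True
    then have "r = of_nat (nat m) * e" by (simp add: m)
    then have "qp r = qp e ^ nat m" using rational_powers_of_nat[OF q] by simp
    then show ?thesis using base_ring_power[OF g(1)] by simp
  next
    case False
    then have "r = of_nat (nat (- m)) * (- e)" by (simp add: m)
    then have "qp r = qp (- e) ^ nat (- m)" using rational_powers_of_nat[OF q, of "nat (- m)" "- e"] by simp
    then show ?thesis using base_ring_power[OF g(2)] by simp
  qed
qed

text \<open>Since \<open>DB\<close> is integral, this embeds the coefficient ring of the \<open>Z\<close>-torus into that of every other torus below.\<close>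

lemma base_ring_mono:
  assumes q: "rational_powers q qp" and sub: "half_exponents M \<subseteq> half_exponents N"
  shows "base_ring qp M \<subseteq> base_ring qp N"
proof
  let ?d = "2 * of_int (common_denominator M) :: rat"
  fix r assume "r \<in> base_ring qp M"
  have e: "of_int m / ?d \<in> half_exponents N" for m
    using sub unfolding half_exponents_def by blast
  from \<open>r \<in> base_ring qp M\<close>[unfolded base_ring_def] show "r \<in> base_ring qp N"
  proof (induction rule: generate_ring.induct)
    case (incl h)
    then show ?case using base_ring_exponent[OF q e[of 1]] base_ring_exponent[OF q e[of "-1"]] by auto
  qed (auto simp: base_ring_one intro: base_ring_minus base_ring_add base_ring_mult)
qed

section \<open>The quantum torus inside its skew field of fractions\<close>

lemma poly_mapping_sum_monomials:
  "(\<Sum>w\<in>Poly_Mapping.keys p. Poly_Mapping.single w (Poly_Mapping.lookup p w)) = p"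
proof (rule poly_mapping_eqI)
  fix k
  have "(\<Sum>w\<in>Poly_Mapping.keys p. Poly_Mapping.lookup p w when w = k) = Poly_Mapping.lookup p k"
    by (simp add: when_def in_keys_iff)
  then show "Poly_Mapping.lookup (\<Sum>w\<in>Poly_Mapping.keys p. Poly_Mapping.single w (Poly_Mapping.lookup p w)) k
      = Poly_Mapping.lookup p k"
    by (simp add: lookup_sum lookup_single)
qed

lemma lookup_times_in_base_ring:
  assumes "\<And>w. Poly_Mapping.lookup p w \<in> base_ring qp M" "\<And>w. Poly_Mapping.lookup p' w \<in> base_ring qp M"
  shows "Poly_Mapping.lookup (p * p') w \<in> base_ring qp M"
proof -
  have "p * p' = (\<Sum>u\<in>Poly_Mapping.keys p. Poly_Mapping.single u (Poly_Mapping.lookup p u))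
      * (\<Sum>v\<in>Poly_Mapping.keys p'. Poly_Mapping.single v (Poly_Mapping.lookup p' v))"
    by (simp add: poly_mapping_sum_monomials)
  also have "\<dots> = (\<Sum>u\<in>Poly_Mapping.keys p. \<Sum>v\<in>Poly_Mapping.keys p'.
      Poly_Mapping.single (u + v) (Poly_Mapping.lookup p u * Poly_Mapping.lookup p' v))"
    by (simp add: sum_distrib_left sum_distrib_right mult_single) (rule sum.swap)
  finally show ?thesis
    by (simp add: lookup_sum lookup_single when_def assms base_ring_zero base_ring_mult base_ring_sum)
qed

lemma free_algebra_simps [simp]:
  "carrier (free_algebra R) = {p. \<forall>w. Poly_Mapping.lookup p w \<in> R}"
  "monoid.mult (free_algebra R) x y = x * y"
  "monoid.one (free_algebra R) = 1"
  "ring.zero (free_algebra R) = 0"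
  "ring.add (free_algebra R) x y = x + y"
  by (simp_all add: free_algebra_def ring_of_type_algebra_def)

lemma ring_free_algebra: "ring (free_algebra (base_ring qp M) :: ('a free_mon \<Rightarrow>\<^sub>0 'k::field) ring)"
proof (rule ringI)
  let ?A = "free_algebra (base_ring qp M) :: ('a free_mon \<Rightarrow>\<^sub>0 'k) ring"
  have "\<exists>y\<in>carrier ?A. y + x = 0" if "x \<in> carrier ?A" for x
    by (rule bexI[of _ "- x"]) (use that in \<open>simp_all add: base_ring_minus lookup_uminus\<close>)
  then show "abelian_group ?A"
    by (intro abelian_groupI) (simp_all add: add.assoc add.commute lookup_add base_ring_add base_ring_zero)
  show "monoid ?A"
    by (rule monoidI)
      (simp_all add: mult.assoc lookup_times_in_base_ring lookup_one when_def base_ring_zero base_ring_one)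
qed (simp_all add: algebra_simps)

lemma single_in_free_algebra: "r \<in> base_ring qp M \<Longrightarrow> Poly_Mapping.single w r \<in> carrier (free_algebra (base_ring qp M))"
  by (simp add: lookup_single when_def base_ring_zero)

text \<open>A quantum torus with a skew field of fractions, for any skew-symmetric matrix \<open>L\<close>. The two uses are
  \<open>L = \<Lambda>\<close> and \<open>L = DB\<close>, for a quiver and for its mutation.\<close>

locale quantum_torus_field =
  fixes q :: "'k::field" and qp :: "rat \<Rightarrow> 'k"
    and L :: "rat^'n::{finite,linorder}^'n::{finite,linorder}"
    and \<iota> :: "('n, 'k, 'f::division_ring) torus_map"
  assumes powers: "rational_powers q qp"
    and fraction_field: "is_skew_fraction_field (quantum_torus qp L) \<iota>"
    and skew: "L$i$j = - L$j$i"
begin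

abbreviation R :: "'k set" where "R \<equiv> base_ring qp L"

abbreviation A :: "('n letter free_mon \<Rightarrow>\<^sub>0 'k) ring" where "A \<equiv> free_algebra R"

text \<open>The value in the skew field of a noncommutative polynomial in the letters. All computations happen
  through this ring homomorphism, so that cosets of the defining ideal need no further mention.\<close>

definition eval :: "('n letter free_mon \<Rightarrow>\<^sub>0 'k) \<Rightarrow> 'f" where
  "eval p = \<iota> (torus_class qp L p)"

lemma relations_subset: "torus_relations qp L \<subseteq> carrier A"
proof -
  have e: "qp (L$i$j) \<in> R" for i j
    by (rule base_ring_exponent[OF powers half_exponents_entry])
  have m: "- 1 \<in> R" by (rule base_ring_minus[OF base_ring_one])
  show ?thesis
    unfolding torus_relations_def
    by (auto simp: lookup_minus lookup_one lookup_single when_def base_ring_zero base_ring_one base_ring_minus m e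
       intro!: base_ring_add[of _ _ _ "- _", simplified])
qed

lemma torus_ideal: "ideal (torus_ideal qp L) A"
  unfolding torus_ideal_def by (rule ring.genideal_ideal[OF ring_free_algebra relations_subset])

lemma torus_class_hom: "torus_class qp L \<in> ring_hom A (quantum_torus qp L)"
  unfolding torus_class_def[abs_def] quantum_torus_def
  using ideal.rcos_ring_hom[OF torus_ideal] by simp

lemma eval_hom: "eval \<in> ring_hom A ring_of_type_algebra"
proof -
  have "\<iota> \<circ> torus_class qp L \<in> ring_hom A ring_of_type_algebra"
    using ring_hom_trans[OF torus_class_hom] fraction_field
    unfolding is_skew_fraction_field_def by blast
  then show ?thesis by (simp add: eval_def[abs_def] comp_def)
qed

lemma eval_add: "p \<in> carrier A \<Longrightarrow> p' \<in> carrier A \<Longrightarrow> eval (p + p') = eval p + eval p'"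
  using ring_hom_add[OF eval_hom, of p p'] by simp

lemma eval_mult: "p \<in> carrier A \<Longrightarrow> p' \<in> carrier A \<Longrightarrow> eval (p * p') = eval p * eval p'"
  using ring_hom_mult[OF eval_hom, of p p'] by simp

lemma eval_one: "eval 1 = 1"
  using ring_hom_one[OF eval_hom] by simp

lemma eval_zero: "eval 0 = 0"
  using eval_add[of 0 0] by (simp add: base_ring_zero)

lemma eval_relation:
  assumes "p - p' \<in> torus_relations qp L" "p' \<in> carrier A"
  shows "eval p = eval p'"
proof -
  interpret I: ideal "torus_ideal qp L" A by (rule torus_ideal)
  have in_A: "p - p' \<in> carrier A" using assms(1) relations_subset by blast
  have "p - p' \<in> torus_ideal qp L"
    unfolding torus_ideal_def
    using ring.genideal_self[OF ring_free_algebra relations_subset] assms(1) by blast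
  then have "torus_class qp L (p - p') = torus_class qp L 0"
    unfolding torus_class_def using I.a_rcos_const I.additive_subgroup_axioms additive_subgroup.zero_closed
    by (metis free_algebra_simps(4))
  then have "eval (p - p') = 0" using eval_zero by (simp add: eval_def)
  then have "eval (p - p' + p') = eval p'" using eval_add[OF in_A assms(2)] by simp
  then show ?thesis by simp
qed

subsection \<open>Scalars and generators\<close>

abbreviation scal :: "'k \<Rightarrow> 'f" where "scal \<equiv> torus_scalar qp L \<iota>"
abbreviation gen :: "'n \<Rightarrow> 'f" where "gen \<equiv> torus_gen qp L \<iota>"
abbreviation monomial :: "int^'n::{finite,linorder} \<Rightarrow> 'f" where "monomial \<equiv> torus_monomial qp L \<iota>"

lemma scal_eval: "scal r = eval (Poly_Mapping.single 0 r)"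
  by (simp add: torus_scalar_def eval_def)

lemma gen_eval: "gen i = eval (Poly_Mapping.single (Mon [Gen i]) 1)"
  by (simp add: torus_gen_def eval_def)

lemmas single_carrier = single_in_free_algebra[of _ qp L]

lemma scal_mult: "r \<in> R \<Longrightarrow> s \<in> R \<Longrightarrow> scal (r * s) = scal r * scal s"
  using eval_mult[OF single_carrier single_carrier, of r s 0 0] by (simp add: scal_eval mult_single)

lemma scal_one: "scal 1 = 1"
  using eval_one by (simp add: scal_eval single_one)

lemma scal_eval_mult: "r \<in> R \<Longrightarrow> eval (Poly_Mapping.single w r) = scal r * eval (Poly_Mapping.single w 1)"
  using eval_mult[OF single_carrier single_carrier, of r 1 0 w] by (simp add: scal_eval mult_single base_ring_one)

lemma scal_eval_mult': "r \<in> R \<Longrightarrow> eval (Poly_Mapping.single w r) = eval (Poly_Mapping.single w 1) * scal r"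
  using eval_mult[OF single_carrier single_carrier, of 1 r w 0] by (simp add: scal_eval mult_single base_ring_one)

lemma word_mult: "eval (Poly_Mapping.single (Mon u) 1) * eval (Poly_Mapping.single (Mon v) 1)
    = eval (Poly_Mapping.single (Mon (u @ v)) 1)"
  using eval_mult[OF single_carrier single_carrier, of 1 1 "Mon u" "Mon v"]
  by (simp add: mult_single base_ring_one)

lemma gen_inverse:
  "gen i * eval (Poly_Mapping.single (Mon [GenInv i]) 1) = 1"
proof -
  have "eval (Poly_Mapping.single (Mon [Gen i, GenInv i]) 1) = eval 1"
    by (rule eval_relation) (auto simp: torus_relations_def lookup_one when_def base_ring_one base_ring_zero)
  then show ?thesis by (simp add: gen_eval word_mult eval_one)
qed

lemma gen_nonzero: "gen i \<noteq> 0"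
  using gen_inverse[of i] by auto

lemma genInv_eval: "eval (Poly_Mapping.single (Mon [GenInv i]) 1) = inverse (gen i)"
  using gen_inverse[of i] by (metis inverse_unique)

lemma gen_commute: "gen i * gen j = scal (qp (L$i$j)) * (gen j * gen i)"
proof -
  have e: "qp (L$i$j) \<in> R" by (rule base_ring_exponent[OF powers half_exponents_entry])
  have "eval (Poly_Mapping.single (Mon [Gen i, Gen j]) 1)
      = eval (Poly_Mapping.single (Mon [Gen j, Gen i]) (qp (L$i$j)))"
    by (rule eval_relation) (use single_carrier[OF e] in \<open>auto simp: torus_relations_def\<close>)
  then show ?thesis by (simp add: gen_eval word_mult scal_eval_mult[OF e])
qed

text \<open>Elements of the torus are polynomials in the generators and their inverses, and every element of the
  skew field is a fraction of two of them. So a property of all elements can be checked on scalars and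
  generators.\<close>

lemma division_ring_induct [case_names scal gen add mult inverse]:
  assumes scal: "\<And>r. r \<in> R \<Longrightarrow> P (scal r)" and gen: "\<And>i. P (gen i)"
    and add: "\<And>x y. P x \<Longrightarrow> P y \<Longrightarrow> P (x + y)"
    and mult: "\<And>x y. P x \<Longrightarrow> P y \<Longrightarrow> P (x * y)"
    and inverse: "\<And>x. P x \<Longrightarrow> P (inverse x)"
  shows "P z"
proof -
  have word: "P (eval (Poly_Mapping.single (Mon w) 1))" for w
  proof (induction w)
    case Nil
    then show ?case using scal[OF base_ring_one] by (simp add: scal_eval zero_free_mon_def)
  next
    case (Cons x w)
    have "P (eval (Poly_Mapping.single (Mon [x]) 1))"
      by (cases x) (use gen inverse in \<open>auto simp: gen_eval genInv_eval\<close>)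
    from mult[OF this Cons] show ?case by (simp add: word_mult)
  qed
  have z: "P 0" using scal[OF base_ring_zero] eval_zero by (simp add: scal_eval)
  have poly: "P (eval p)" if "p \<in> carrier A" for p
  proof -
    have "P (eval (\<Sum>w\<in>S. Poly_Mapping.single w (Poly_Mapping.lookup p w)))
      \<and> (\<Sum>w\<in>S. Poly_Mapping.single w (Poly_Mapping.lookup p w)) \<in> carrier A" if "finite S" for S
      using that
    proof (induction S)
      case empty
      then show ?case by (simp add: eval_zero z base_ring_zero)
    next
      case (insert w S)
      have r: "Poly_Mapping.lookup p w \<in> R" using \<open>p \<in> carrier A\<close> by simp
      have "P (eval (Poly_Mapping.single w (Poly_Mapping.lookup p w)))"
        using scal_eval_mult[OF r, of w] mult[OF scal[OF r] word] by (cases w) simp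
      moreover have m: "Poly_Mapping.single w (Poly_Mapping.lookup p w) \<in> carrier A"
        by (rule single_carrier[OF r])
      moreover have s: "(\<Sum>w\<in>S. Poly_Mapping.single w (Poly_Mapping.lookup p w)) \<in> carrier A"
        using insert by blast
      moreover note ring.ring_simprules(1)[OF ring_free_algebra m s]
      ultimately show ?case
        using insert add eval_add[OF m s] by (simp del: free_algebra_simps(1))
    qed
    from this[of "Poly_Mapping.keys p"] show ?thesis by (simp add: poly_mapping_sum_monomials)
  qed
  have torus: "P (\<iota> a)" if "a \<in> carrier (quantum_torus qp L)" for a
  proof -
    have "\<exists>p\<in>carrier A. a = torus_class qp L p"
      using that unfolding quantum_torus_def FactRing_def torus_class_def A_RCOSETS_def' by auto
    then show ?thesis using poly unfolding eval_def by blast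
  qed
  obtain a b where "a \<in> carrier (quantum_torus qp L)" "b \<in> carrier (quantum_torus qp L)" "z = \<iota> a * inverse (\<iota> b)"
    using fraction_field unfolding is_skew_fraction_field_def by meson
  then show ?thesis using torus mult inverse by blast
qed

text \<open>Scalars are central because they commute with the letters of the free algebra, and commuting with a
  fixed element is inherited by sums, products and inverses.\<close>

lemma scal_central:
  assumes r: "r \<in> R"
  shows "scal r * x = x * scal r"
proof (induction x rule: division_ring_induct)
  case (scal s)
  then show ?case using r scal_mult[of r s] scal_mult[of s r] by (simp add: mult.commute)
next
  case (gen i)
  show ?case
    using scal_eval_mult[OF r, of "Mon [Gen i]"] scal_eval_mult'[OF r, of "Mon [Gen i]"]
    by (simp add: gen_eval)
next
  case (add x y)
  then show ?case by (simp add: distrib_left distrib_right)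
next
  case (mult x y)
  have "scal r * (x * y) = (scal r * x) * y" by (simp only: mult.assoc)
  also have "\<dots> = x * (scal r * y)" by (simp only: mult mult.assoc)
  finally show ?case by (simp only: mult mult.assoc)
next
  case (inverse x)
  show ?case
  proof (cases "x = 0")
    case False
    have "inverse x * (scal r * x) * inverse x = inverse x * (x * scal r) * inverse x"
      by (simp only: inverse)
    then have "inverse x * scal r * (x * inverse x) = (inverse x * x) * (scal r * inverse x)"
      by (simp only: mult.assoc)
    then show ?thesis using False by simp
  qed simp
qed

end

section \<open>Normalised monomials\<close>

context quantum_torus_field
begin

abbreviation qscal :: "rat \<Rightarrow> 'f" where "qscal r \<equiv> scal (qp r)"

lemma qscal_add: "r \<in> half_exponents L \<Longrightarrow> s \<in> half_exponents L \<Longrightarrow> qscal (r + s) = qscal r * qscal s"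
  using scal_mult[OF base_ring_exponent[OF powers] base_ring_exponent[OF powers], of r s] powers
  by (simp add: rational_powers_def)

lemma qscal_zero [simp]: "qscal 0 = 1"
  by (simp add: rational_powers_zero[OF powers] scal_one)

lemma qscal_central: "r \<in> half_exponents L \<Longrightarrow> qscal r * x = x * qscal r"
  by (rule scal_central[OF base_ring_exponent[OF powers]])

lemma qscal_minus: "r \<in> half_exponents L \<Longrightarrow> qscal (- r) * qscal r = 1"
  using qscal_add[OF half_exponents_minus, of r r] by simp

lemma qscal_nonzero: "r \<in> half_exponents L \<Longrightarrow> qscal r \<noteq> 0"
  using qscal_minus[of r] by auto

lemma qscal_left_commute: "r \<in> half_exponents L \<Longrightarrow> x * (qscal r * y) = qscal r * (x * y)"
  by (metis qscal_central mult.assoc)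

text \<open>Commutation up to a power of \<open>q\<close>. The exponent is additive in the left factor, changes sign under
  inversion and under swapping the factors; this yields the commutation of arbitrary powers of the
  generators.\<close>

definition qcommute :: "rat \<Rightarrow> 'f \<Rightarrow> 'f \<Rightarrow> bool" where
  "qcommute r x y \<longleftrightarrow> r \<in> half_exponents L \<and> x * y = qscal r * (y * x)"

lemma qcommute_one: "qcommute 0 1 y"
  by (simp add: qcommute_def half_exponents_zero)

lemma qcommute_mult:
  assumes "qcommute r x y" "qcommute s x' y"
  shows "qcommute (r + s) (x * x') y"
proof -
  have r: "r \<in> half_exponents L" and s: "s \<in> half_exponents L"
    using assms by (auto simp: qcommute_def)
  have "x * x' * y = x * (qscal s * (y * x'))"
    using assms(2) by (simp add: qcommute_def mult.assoc)
  also have "\<dots> = qscal s * (x * y * x')"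
    using s by (simp add: qscal_left_commute mult.assoc)
  also have "\<dots> = qscal s * (qscal r * (y * x) * x')"
    using assms(1) by (simp add: qcommute_def)
  also have "\<dots> = qscal (r + s) * (y * (x * x'))"
    using r s by (simp add: add.commute[of r s] qscal_add mult.assoc)
  finally show ?thesis using r s by (simp add: qcommute_def half_exponents_add)
qed

lemma qcommute_sym: "qcommute r x y \<Longrightarrow> qcommute (- r) y x"
  unfolding qcommute_def
  by (simp add: half_exponents_minus mult.assoc[symmetric] qscal_minus)

lemma qcommute_inverse:
  assumes "qcommute r x y" "x \<noteq> 0"
  shows "qcommute (- r) (inverse x) y"
proof -
  have r: "r \<in> half_exponents L" using assms by (simp add: qcommute_def)
  have "y * inverse x = inverse x * (x * y) * inverse x"
    using assms(2) by (simp add: mult.assoc[symmetric])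
  also have "\<dots> = inverse x * (qscal r * (y * x)) * inverse x"
    using assms(1) by (simp add: qcommute_def)
  also have "\<dots> = qscal r * (inverse x * y)"
    using assms(2) r by (simp add: qscal_left_commute mult.assoc)
  finally have "qcommute r y (inverse x)" using r by (simp add: qcommute_def)
  then show ?thesis by (rule qcommute_sym)
qed

lemma qcommute_powi:
  assumes "qcommute r x y" "x \<noteq> 0"
  shows "qcommute (of_int m * r) (x powi m) y"
proof -
  have n: "qcommute (of_nat k * s) (x' ^ k) y" if "qcommute s x' y" for k s x'
  proof (induction k)
    case (Suc k)
    then show ?case using qcommute_mult[OF that Suc] by (simp add: algebra_simps)
  qed (simp add: qcommute_one)
  show ?thesis
  proof (cases "m \<ge> 0")
    case True
    then show ?thesis using n[OF assms(1), of "nat m"] by (simp add: power_int_def)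
  next
    case False
    then show ?thesis using n[OF qcommute_inverse[OF assms], of "nat (- m)"] by (simp add: power_int_def)
  qed
qed

lemma qcommute_powi_powi:
  assumes "qcommute r x y" "x \<noteq> 0" "y \<noteq> 0"
  shows "qcommute (of_int m * r * of_int k) (x powi m) (y powi k)"
  using qcommute_sym[OF qcommute_powi[OF qcommute_sym[OF qcommute_powi[OF assms(1,2)]] assms(3)], of k m]
  by (simp add: mult.assoc mult.left_commute mult.commute)

lemma qcommute_prod_list:
  assumes "\<And>i. i \<in> set xs \<Longrightarrow> qcommute (r i) (f i) y" "distinct xs"
  shows "qcommute (\<Sum>i\<in>set xs. r i) (prod_list (map f xs)) y"
  using assms by (induction xs) (auto simp: qcommute_one intro!: qcommute_mult)

lemma gen_qcommute: "qcommute (of_int m * L$i$j * of_int k) (gen i powi m) (gen j powi k)"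
  by (rule qcommute_powi_powi)
    (simp_all add: qcommute_def gen_commute[of i j] gen_nonzero half_exponents_entry)

abbreviation ordered_product :: "'n list \<Rightarrow> int^'n::{finite,linorder} \<Rightarrow> 'f" where
  "ordered_product xs a \<equiv> prod_list (map (\<lambda>i. gen i powi (a$i)) xs)"

text \<open>Moving the letters of the second product into place creates one factor for each pair \<open>j < i\<close> whose
  letters stand in the wrong order.\<close>

lemma ordered_product_mult:
  assumes "sorted_wrt (<) xs"
  shows "ordered_product xs a * ordered_product xs b =
    qscal (\<Sum>j\<in>set xs. \<Sum>i\<in>{i\<in>set xs. j < i}. of_int (a$i) * L$i$j * of_int (b$j)) * ordered_product xs (a + b)"
  using assms
proof (induction xs)
  case (Cons x xs)
  define c where "c = (\<Sum>j\<in>set xs. \<Sum>i\<in>{i\<in>set xs. j < i}. of_int (a$i) * L$i$j * of_int (b$j))"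
  define d where "d = (\<Sum>i\<in>set xs. of_int (a$i) * L$i$x * of_int (b$x))"
  have e: "of_int (a$i) * L$i$j * of_int (b$j) \<in> half_exponents L" for i j
    using gen_qcommute[of "a$i" i j "b$j"] unfolding qcommute_def by (rule conjunct1)
  have c: "c \<in> half_exponents L" and d: "d \<in> half_exponents L"
    unfolding c_def d_def by (intro half_exponents_sum e)+
  have lt: "\<And>i. i \<in> set xs \<Longrightarrow> x < i" and sorted: "sorted_wrt (<) xs" using Cons.prems by auto
  have x: "x \<notin> set xs" using lt[of x] by blast
  have dist: "distinct xs" using sorted strict_sorted_iff by blast
  have "(\<Sum>j\<in>set (x # xs). \<Sum>i\<in>{i\<in>set (x # xs). j < i}. of_int (a$i) * L$i$j * of_int (b$j))
      = (\<Sum>i\<in>{i\<in>set (x # xs). x < i}. of_int (a$i) * L$i$x * of_int (b$x))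
      + (\<Sum>j\<in>set xs. \<Sum>i\<in>{i\<in>set (x # xs). j < i}. of_int (a$i) * L$i$j * of_int (b$j))"
    using x by simp
  also have "{i\<in>set (x # xs). x < i} = set xs" by (auto dest: lt)
  also have "(\<Sum>j\<in>set xs. \<Sum>i\<in>{i\<in>set (x # xs). j < i}. of_int (a$i) * L$i$j * of_int (b$j)) = c"
    unfolding c_def
  proof (rule sum.cong[OF refl])
    fix j assume "j \<in> set xs"
    then have "\<not> j < x" using lt[of j] by simp
    then have "{i\<in>set (x # xs). j < i} = {i\<in>set xs. j < i}" by auto
    then show "(\<Sum>i\<in>{i\<in>set (x # xs). j < i}. of_int (a$i) * L$i$j * of_int (b$j))
      = (\<Sum>i\<in>{i\<in>set xs. j < i}. of_int (a$i) * L$i$j * of_int (b$j))" by simp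
  qed
  finally have split: "(\<Sum>j\<in>set (x # xs). \<Sum>i\<in>{i\<in>set (x # xs). j < i}. of_int (a$i) * L$i$j * of_int (b$j)) = d + c"
    by (simp add: d_def)
  have "qcommute d (ordered_product xs a) (gen x powi (b$x))"
    unfolding d_def by (rule qcommute_prod_list[OF _ dist]) (rule gen_qcommute)
  then have comm: "ordered_product xs a * gen x powi (b$x) = qscal d * (gen x powi (b$x) * ordered_product xs a)"
    by (simp add: qcommute_def)
  have "ordered_product (x # xs) a * ordered_product (x # xs) b
      = gen x powi (a$x) * (ordered_product xs a * gen x powi (b$x)) * ordered_product xs b"
    by (simp add: mult.assoc)
  also have "\<dots> = qscal d * (gen x powi (a$x) * gen x powi (b$x)) * (ordered_product xs a * ordered_product xs b)"
    unfolding comm by (simp only: mult.assoc qscal_left_commute[OF d, of "gen x powi (a$x)"])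
  also have "\<dots> = qscal d * gen x powi (a$x + b$x) * (qscal c * ordered_product xs (a + b))"
    using Cons.IH[OF sorted] gen_nonzero by (simp add: c_def power_int_add)
  also have "\<dots> = qscal (d + c) * ordered_product (x # xs) (a + b)"
    by (simp add: qscal_add[OF d c] mult.assoc qscal_left_commute[OF c, of "gen x powi (a$x + b$x)"])
  finally show ?case unfolding split .
qed simp

abbreviation norm_exponent :: "int^'n::{finite,linorder} \<Rightarrow> rat" where
  "norm_exponent a \<equiv> - (1/2) * (\<Sum>j\<in>UNIV. \<Sum>i\<in>{..<j}. L$i$j * of_int (a$i) * of_int (a$j))"

lemma norm_exponent_in: "norm_exponent a \<in> half_exponents L"
proof -
  have eq: "- (1/2) * (L$i$j * of_int (a$i) * of_int (a$j)) = of_int (- (a$i * a$j)) * (L$i$j / 2)" for i j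
    by simp
  show ?thesis
    unfolding sum_distrib_left eq
    by (intro half_exponents_sum half_exponents_mult_int half_exponents_half_entry)
qed

text \<open>This is why the normalising factor \<open>q\<close> to the \<open>- \<Sum>\<^sub>i\<^sub><\<^sub>j \<lambda>\<^sub>i\<^sub>j a\<^sub>i a\<^sub>j / 2\<close> is the right one: it turns the
  sum over the pairs \<open>j < i\<close> into half of the full skew form. The pairs \<open>i < j\<close> and \<open>j < i\<close> are exchanged
  by skew symmetry.\<close>

lemma norm_exponent_add:
  "norm_exponent a + norm_exponent b + (\<Sum>j\<in>UNIV. \<Sum>i\<in>{i. j < i}. of_int (a$i) * L$i$j * of_int (b$j))
    = lattice_form L a b / 2 + norm_exponent (a + b)"
proof -
  define u where "u = (\<Sum>j\<in>UNIV. \<Sum>i\<in>{..<j}. of_int (a$i) * L$i$j * of_int (b$j))"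
  define c where "c = (\<Sum>j\<in>UNIV. \<Sum>i\<in>{i. j < i}. of_int (a$i) * L$i$j * of_int (b$j))"
  define n where "n a = (\<Sum>j\<in>UNIV. \<Sum>i\<in>{..<j}. L$i$j * of_int (a$i) * of_int (a$j))" for a :: "int^'n::{finite,linorder}"
  have diag: "L$i$i = 0" for i using skew[of i i] by simp
  have "lattice_form L a b = (\<Sum>j\<in>UNIV. \<Sum>i\<in>UNIV. of_int (a$i) * L$i$j * of_int (b$j))"
    unfolding lattice_form_def by (rule sum.swap)
  also have "\<dots> = (\<Sum>j\<in>UNIV. (\<Sum>i\<in>{..<j}. of_int (a$i) * L$i$j * of_int (b$j)) + (\<Sum>i\<in>{i. j < i}. of_int (a$i) * L$i$j * of_int (b$j)))"
  proof (rule sum.cong[OF refl])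
    fix j :: 'n
    let ?f = "\<lambda>i. of_int (a$i) * L$i$j * of_int (b$j)"
    have "(UNIV :: 'n set) = insert j ({..<j} \<union> {i. j < i})" by auto
    then have "sum ?f UNIV = sum ?f (insert j ({..<j} \<union> {i. j < i}))" by simp
    also have "\<dots> = sum ?f ({..<j} \<union> {i. j < i})" by (simp add: diag)
    also have "\<dots> = sum ?f {..<j} + sum ?f {i. j < i}" by (rule sum.union_disjoint) auto
    finally show "sum ?f UNIV = sum ?f {..<j} + sum ?f {i. j < i}" .
  qed
  also have "\<dots> = u + c" by (simp add: u_def c_def sum.distrib)
  finally have lattice_form: "lattice_form L a b = u + c" .
  have "(\<Sum>j\<in>UNIV. \<Sum>i\<in>{..<j}. L$i$j * of_int (b$i) * of_int (a$j))
      = (\<Sum>j\<in>UNIV. \<Sum>i\<in>UNIV. if i < j then L$i$j * of_int (b$i) * of_int (a$j) else 0)"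
    by (simp add: sum.If_cases lessThan_def)
  also have "\<dots> = (\<Sum>i\<in>UNIV. \<Sum>j\<in>UNIV. if i < j then L$i$j * of_int (b$i) * of_int (a$j) else 0)"
    by (rule sum.swap)
  also have "\<dots> = (\<Sum>i\<in>UNIV. \<Sum>j\<in>{j. i < j}. L$i$j * of_int (b$i) * of_int (a$j))"
    by (simp add: sum.If_cases)
  also have "\<dots> = - c"
    unfolding c_def sum_negf[symmetric]
  proof (intro sum.cong refl)
    fix i j :: 'n
    have "L$i$j = - L$j$i" by (rule skew)
    then show "L$i$j * of_int (b$i) * of_int (a$j) = - (of_int (a$j) * L$j$i * of_int (b$i))"
      by (simp only: mult_minus_left mult_ac)
  qed
  finally have swap: "(\<Sum>j\<in>UNIV. \<Sum>i\<in>{..<j}. L$i$j * of_int (b$i) * of_int (a$j)) = - c" .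
  have "n (a + b) = n a + n b + u + (\<Sum>j\<in>UNIV. \<Sum>i\<in>{..<j}. L$i$j * of_int (b$i) * of_int (a$j))"
    unfolding n_def u_def sum.distrib[symmetric]
    by (intro sum.cong refl) (simp add: distrib_left distrib_right mult_ac)
  then have "n (a + b) = n a + n b + u - c" by (simp add: swap)
  then have "- (1/2) * n a + - (1/2) * n b + c = lattice_form L a b / 2 + - (1/2) * n (a + b)"
    unfolding lattice_form by (simp add: add_divide_distrib diff_divide_distrib)
  then show ?thesis unfolding n_def c_def .
qed

lemma monomial_mult: "monomial a * monomial b = qscal (lattice_form L a b / 2) * monomial (a + b)"
proof -
  let ?xs = "sorted_list_of_set (UNIV :: 'n set)"
  define c where "c = (\<Sum>j\<in>UNIV. \<Sum>i\<in>{i. j < i}. of_int (a$i) * L$i$j * of_int (b$j))"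
  have e: "of_int (a$i) * L$i$j * of_int (b$j) \<in> half_exponents L" for i j
    using gen_qcommute[of "a$i" i j "b$j"] unfolding qcommute_def by (rule conjunct1)
  have c: "c \<in> half_exponents L"
    unfolding c_def by (intro half_exponents_sum e)
  define N where "N a = norm_exponent a" for a
  have n: "N a \<in> half_exponents L" for a unfolding N_def by (rule norm_exponent_in)
  have N_add: "N a + N b + c = lattice_form L a b / 2 + N (a + b)"
    unfolding N_def c_def by (rule norm_exponent_add)
  have monomial_eq: "monomial a = qscal (N a) * ordered_product ?xs a" for a
    unfolding N_def by (rule torus_monomial_def)
  have prod: "ordered_product ?xs a * ordered_product ?xs b = qscal c * ordered_product ?xs (a + b)"
    using ordered_product_mult[of ?xs a b] by (simp add: c_def)
  have "monomial a * monomial b = qscal (N a) * (qscal (N b) * (ordered_product ?xs a * ordered_product ?xs b))"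
    by (simp only: monomial_eq mult.assoc qscal_left_commute[OF n, of "ordered_product ?xs a" b])
  also have "\<dots> = qscal (N a + N b + c) * ordered_product ?xs (a + b)"
    unfolding prod by (simp only: qscal_add half_exponents_add n c mult.assoc)
  also have "\<dots> = qscal (lattice_form L a b / 2) * monomial (a + b)"
    by (simp only: N_add monomial_eq qscal_add[OF half_exponents_half_lattice_form n] mult.assoc)
  finally show ?thesis .
qed

lemma monomial_zero [simp]: "monomial 0 = 1"
proof -
  have "prod_list (map (\<lambda>i. 1) xs) = (1 :: 'f)" for xs :: "'n list" by (induction xs) simp_all
  then show ?thesis by (simp add: torus_monomial_def)
qed

lemma monomial_axis: "monomial (axis i 1) = gen i"
proof -
  have "ordered_product xs (axis i 1) = (if i \<in> set xs then gen i else 1)" if "distinct xs" for xs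
    using that by (induction xs) (auto simp: axis_def)
  moreover have "(\<Sum>j\<in>UNIV. \<Sum>i'\<in>{..<j}. L$i'$j * of_int ((axis i 1 :: int^'n::{finite,linorder})$i') * of_int ((axis i 1 :: int^'n::{finite,linorder})$j)) = 0"
    by (intro sum.neutral ballI) (auto simp: axis_def)
  ultimately show ?thesis by (simp only: torus_monomial_def) simp
qed

lemma monomial_minus: "monomial a * monomial (- a) = 1"
  by (simp add: monomial_mult lattice_form_minus_right lattice_form_self[OF skew])

lemma monomial_nonzero: "monomial a \<noteq> 0"
  using monomial_minus[of a] by auto

lemma inverse_monomial: "inverse (monomial a) = monomial (- a)"
  using monomial_minus[of a] by (metis inverse_unique)

lemma monomial_commute: "monomial a * monomial b = qscal (lattice_form L a b) * (monomial b * monomial a)"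
proof -
  have h: "lattice_form L b a / 2 \<in> half_exponents L" "lattice_form L a b \<in> half_exponents L"
    by (rule half_exponents_half_lattice_form half_exponents_lattice_form)+
  have "qscal (lattice_form L a b) * (monomial b * monomial a) = qscal (lattice_form L a b + lattice_form L b a / 2) * monomial (a + b)"
    using h by (simp add: monomial_mult qscal_add mult.assoc add.commute)
  also have "lattice_form L a b + lattice_form L b a / 2 = lattice_form L a b / 2"
    using lattice_form_swap[OF skew, of b a] by simp
  finally show ?thesis by (simp add: monomial_mult)
qed

end

section \<open>Compatible pairs and their mutation\<close>

text \<open>The compatibility \<open>\<Lambda> B = - D\<close> of a quantum cluster structure, stated for an arbitrary \<open>\<Lambda>\<close>. It
  determines \<open>\<Lambda>\<close> and is easier to transport along a mutation than the inverse matrix in the definition of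
  \<open>\<Lambda>\<close>.\<close>

definition compatible_pair :: "rat^'n^'n \<Rightarrow> int^'n^'n \<Rightarrow> ('n::finite \<Rightarrow> nat) \<Rightarrow> bool" where
  "compatible_pair M B D \<longleftrightarrow> (\<forall>i. D i > 0) \<and> (\<forall>i j. M$i$j = - M$j$i) \<and>
    (\<forall>i j. (\<Sum>l\<in>UNIV. M$i$l * of_int (B$l$j)) = (if i = j then - of_nat (D i) else 0))"

lemma compatible_pair_skew: "compatible_pair M B D \<Longrightarrow> M$i$j = - M$j$i"
  unfolding compatible_pair_def by blast

lemma compatible_pair_pos: "compatible_pair M B D \<Longrightarrow> D i > 0"
  unfolding compatible_pair_def by blast

lemma compatible_pair_entry:
  "compatible_pair M B D \<Longrightarrow> (\<Sum>l\<in>UNIV. M$i$l * of_int (B$l$j)) = (if i = j then - of_nat (D i) else 0)"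
  unfolding compatible_pair_def by blast

lemma matrix_mult_minus_left: "(- A) ** B = - (A ** (B :: 'a::ring_1^'n::finite^'n))"
  by (simp add: matrix_matrix_mult_def vec_eq_iff sum_negf)

lemma matrix_mult_minus_right: "A ** (- B) = - (A ** (B :: 'a::ring_1^'n::finite^'n))"
  by (simp add: matrix_matrix_mult_def vec_eq_iff sum_negf)

lemma transpose_minus: "transpose (- A) = - transpose (A :: 'a::ring_1^'n^'n)"
  by (simp add: transpose_def vec_eq_iff)

lemma transpose_diag_matrix: "transpose (diag_matrix D) = diag_matrix D"
  by (simp add: transpose_def diag_matrix_def vec_eq_iff)

lemma diag_matrix_mult_entry: "(diag_matrix D ** A)$i$j = of_nat (D i) * A$i$j"
proof -
  have "(diag_matrix D ** A)$i$j = (\<Sum>l\<in>UNIV. if l = i then of_nat (D i) * A$l$j else 0)"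
    unfolding matrix_matrix_mult_def diag_matrix_def vec_lambda_beta by (intro sum.cong refl) auto
  then show ?thesis by simp
qed

lemma mult_diag_matrix_entry: "(A ** diag_matrix D)$i$j = A$i$j * of_nat (D j)"
proof -
  have "(A ** diag_matrix D)$i$j = (\<Sum>l\<in>UNIV. if l = j then A$i$l * of_nat (D j) else 0)"
    unfolding matrix_matrix_mult_def diag_matrix_def vec_lambda_beta by (intro sum.cong refl) auto
  then show ?thesis by simp
qed

lemma matrix_inv_of_invertible:
  assumes "invertible A"
  shows "A ** matrix_inv A = mat 1" "matrix_inv A ** A = mat 1"
proof -
  have "A ** matrix_inv A = mat 1 \<and> matrix_inv A ** A = mat 1"
    using assms unfolding invertible_def matrix_inv_def by (rule someI_ex)
  then show "A ** matrix_inv A = mat 1" "matrix_inv A ** A = mat 1" by blast+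
qed

lemma DB_matrix_entry: "DB_matrix B D $ i $ j = of_int (int (D i) * B$i$j)"
  by (simp add: DB_matrix_def diag_matrix_mult_entry rat_matrix_def map_matrix_def)

text \<open>Skew symmetry of \<open>DB\<close> reads \<open>D B = - B\<^sup>T D\<close>; multiplying by \<open>(B\<^sup>T)\<^sup>-\<^sup>1\<close> from the left and by
  \<open>B\<^sup>-\<^sup>1\<close> from the right gives the skew symmetry of \<open>\<Lambda>\<close>.\<close>

lemma compatible_pair_Lambda:
  assumes "invertible_valued_quiver B D"
  shows "compatible_pair (Lambda_matrix B D) B D"
proof -
  let ?R = "rat_matrix B" and ?D = "diag_matrix D"
  let ?I = "matrix_inv ?R"
  have "invertible ?R" and pos: "\<forall>i. D i > 0"
    and sk: "\<And>i j. int (D i) * B$i$j = - (int (D j) * B$j$i)"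
    using assms unfolding invertible_valued_quiver_def by blast+
  note inv = matrix_inv_of_invertible[OF \<open>invertible ?R\<close>]
  have LB: "Lambda_matrix B D ** ?R = - ?D"
    by (simp add: Lambda_matrix_def matrix_mult_minus_left matrix_mul_assoc[symmetric] inv)
  have "?D ** ?R = - (transpose ?R ** ?D)"
  proof -
    have "(?D ** ?R)$i$j = - (transpose ?R ** ?D)$i$j" for i j
    proof -
      have "(?D ** ?R)$i$j = of_int (int (D i) * B$i$j)"
        using DB_matrix_entry[of B D i j] by (simp add: DB_matrix_def)
      also have "\<dots> = - of_int (int (D j) * B$j$i)" unfolding sk[of i j] by simp
      finally show ?thesis
        by (simp add: mult_diag_matrix_entry transpose_def rat_matrix_def map_matrix_def)
    qed
    then show ?thesis by (simp add: vec_eq_iff)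
  qed
  then have "transpose ?I ** (?D ** ?R) ** ?I = - (transpose ?I ** (transpose ?R ** ?D) ** ?I)"
    by (simp add: matrix_mult_minus_left matrix_mult_minus_right)
  moreover have "transpose ?I ** (?D ** ?R) ** ?I = transpose ?I ** ?D"
    by (simp add: matrix_mul_assoc[symmetric] inv)
  moreover have "transpose ?I ** (transpose ?R ** ?D) ** ?I = ?D ** ?I"
  proof -
    have "transpose ?I ** transpose ?R = mat 1"
      using matrix_transpose_mul[of ?R ?I] by (simp only: inv transpose_mat)
    then show ?thesis by (simp add: matrix_mul_assoc)
  qed
  ultimately have tr: "transpose ?I ** ?D = - (?D ** ?I)" by simp
  have sym: "transpose (Lambda_matrix B D) = - Lambda_matrix B D"
    unfolding Lambda_matrix_def by (simp add: transpose_minus matrix_transpose_mul transpose_diag_matrix tr)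
  have "Lambda_matrix B D $ i $ j = - Lambda_matrix B D $ j $ i" for i j
  proof -
    have "transpose (Lambda_matrix B D) $ j $ i = (- Lambda_matrix B D) $ j $ i" by (simp only: sym)
    then show ?thesis by (simp only: transpose_def vec_lambda_beta vector_uminus_component)
  qed
  moreover have "(\<Sum>l\<in>UNIV. Lambda_matrix B D $i$l * of_int (B$l$j)) = (if i = j then - of_nat (D i) else 0)" for i j
  proof -
    have "(Lambda_matrix B D ** ?R)$i$j = (- ?D)$i$j" by (simp only: LB)
    then show ?thesis by (auto simp: matrix_matrix_mult_def rat_matrix_def map_matrix_def diag_matrix_def)
  qed
  ultimately show ?thesis unfolding compatible_pair_def using pos by blast
qed

text \<open>Since \<open>D\<close> is invertible, \<open>M B = - D\<close> provides a left inverse of \<open>B\<close>. So the invertibility of a mutated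
  matrix comes for free once its compatible partner is known.\<close>

lemma Lambda_matrix_eqI:
  assumes "compatible_pair M B D"
  shows "Lambda_matrix B D = M"
proof -
  let ?R = "rat_matrix B" and ?D = "diag_matrix D"
  \<comment> \<open>The inverse of \<open>- D\<close>.\<close>
  let ?V = "(\<chi> i j. if i = j then - 1 / of_nat (D i) else 0) :: rat^'a^'a"
  have MB: "M ** ?R = - ?D"
    by (simp add: vec_eq_iff matrix_matrix_mult_def rat_matrix_def map_matrix_def diag_matrix_def
        compatible_pair_entry[OF assms])
  have "(?V ** (- ?D))$i$j = (mat 1)$i$j" for i j
  proof -
    have "(?V ** (- ?D))$i$j = (- (?V ** ?D))$i$j" by (simp only: matrix_mult_minus_right)
    also have "\<dots> = (mat 1)$i$j"
      using compatible_pair_pos[OF assms, of j] by (simp add: mult_diag_matrix_entry mat_def)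
    finally show ?thesis .
  qed
  then have "?V ** (- ?D) = mat 1" by (simp add: vec_eq_iff)
  then have "(?V ** M) ** ?R = mat 1" by (simp add: matrix_mul_assoc[symmetric] MB)
  then have "invertible ?R" by (auto simp: invertible_left_inverse)
  then have inv: "?R ** matrix_inv ?R = mat 1" by (rule matrix_inv_of_invertible)
  have "Lambda_matrix B D = (M ** ?R) ** matrix_inv ?R"
    unfolding Lambda_matrix_def MB by (simp add: matrix_mult_minus_left)
  also have "\<dots> = M" by (simp add: matrix_mul_assoc[symmetric] inv)
  finally show ?thesis .
qed

lemma lattice_form_matrix_vector_mult:
  assumes "compatible_pair M B D"
  shows "lattice_form M x (B *v e) = - of_int (\<Sum>l\<in>UNIV. x$l * int (D l) * e$l)"
proof -
  have "lattice_form M x (B *v e) = (\<Sum>i\<in>UNIV. \<Sum>l\<in>UNIV. \<Sum>j\<in>UNIV. of_int (x$i) * (M$i$l * of_int (B$l$j)) * of_int (e$j))"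
    unfolding lattice_form_def matrix_vector_mult_def by (simp add: sum_distrib_left mult.assoc)
  also have "\<dots> = (\<Sum>i\<in>UNIV. \<Sum>j\<in>UNIV. \<Sum>l\<in>UNIV. of_int (x$i) * (M$i$l * of_int (B$l$j)) * of_int (e$j))"
    by (rule sum.cong[OF refl], rule sum.swap)
  also have "\<dots> = (\<Sum>i\<in>UNIV. \<Sum>j\<in>UNIV. of_int (x$i) * (\<Sum>l\<in>UNIV. M$i$l * of_int (B$l$j)) * of_int (e$j))"
    by (simp only: sum_distrib_left sum_distrib_right)
  also have "\<dots> = (\<Sum>i\<in>UNIV. \<Sum>j\<in>UNIV. if j = i then - (of_int (x$i) * of_nat (D i) * of_int (e$i)) else 0)"
  proof (intro sum.cong refl)
    fix i j
    have "(\<Sum>l\<in>UNIV. M$i$l * of_int (B$l$j)) = (if i = j then - of_nat (D i) else 0)"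
      by (rule compatible_pair_entry[OF assms])
    then show "of_int (x$i) * (\<Sum>l\<in>UNIV. M$i$l * of_int (B$l$j)) * of_int (e$j)
      = (if j = i then - (of_int (x$i) * of_nat (D i) * of_int (e$i)) else 0)" by simp
  qed
  also have "\<dots> = - of_int (\<Sum>l\<in>UNIV. x$l * int (D l) * e$l)" by (simp add: sum_negf)
  finally show ?thesis .
qed

lemma matrix_vector_axis_entry: "(B *v axis j 1)$i = (B$i$j :: int)"
proof -
  have "(B *v axis j 1)$i = (\<Sum>l\<in>UNIV. if l = j then B$i$l else 0)"
    unfolding matrix_vector_mult_def vec_lambda_beta by (intro sum.cong refl) (simp add: axis_def)
  then show ?thesis by simp
qed

text \<open>\<open>DB\<close> is the pullback \<open>B\<^sup>T \<Lambda> B\<close> of the skew form \<open>\<Lambda>\<close>.\<close>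

lemma compatible_pair_DB_skew:
  assumes "compatible_pair M B D"
  shows "int (D i) * B$i$j = - (int (D j) * B$j$i)"
proof -
  have entry: "lattice_form M (B *v axis i 1) (B *v axis j 1) = - of_int (int (D j) * B$j$i)" for i j
  proof -
    have "(\<Sum>l\<in>UNIV. (B *v axis i 1)$l * int (D l) * axis j 1$l) = (\<Sum>l\<in>UNIV. if l = j then B$l$i * int (D l) else 0)"
      by (intro sum.cong refl) (simp only: matrix_vector_axis_entry, simp add: axis_def)
    then show ?thesis unfolding lattice_form_matrix_vector_mult[OF assms] by (simp add: mult.commute)
  qed
  have "lattice_form M (B *v axis i 1) (B *v axis j 1) = - lattice_form M (B *v axis j 1) (B *v axis i 1)"
    by (rule lattice_form_swap) (rule compatible_pair_skew[OF assms])
  then have "rat_of_int (int (D i) * B$i$j) = of_int (- (int (D j) * B$j$i))" unfolding entry by simp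
  then show ?thesis by (simp only: of_int_eq_iff)
qed

lemma DB_matrix_skew: "compatible_pair M B D \<Longrightarrow> DB_matrix B D $ i $ j = - DB_matrix B D $ j $ i"
  unfolding DB_matrix_entry of_int_minus[symmetric] of_int_eq_iff by (rule compatible_pair_DB_skew)

lemma lattice_form_DB_matrix:
  assumes "compatible_pair M B D"
  shows "lattice_form M (B *v e) (B *v f) = lattice_form (DB_matrix B D) e f"
proof -
  have "lattice_form M (B *v e) (B *v f) = of_int (\<Sum>l\<in>UNIV. \<Sum>j\<in>UNIV. - (B$l$j * e$j * int (D l) * f$l))"
    unfolding lattice_form_matrix_vector_mult[OF assms] unfolding matrix_vector_mult_def
    by (simp add: sum_distrib_right sum_negf)
  also have "(\<Sum>l\<in>UNIV. \<Sum>j\<in>UNIV. - (B$l$j * e$j * int (D l) * f$l)) = (\<Sum>l\<in>UNIV. \<Sum>j\<in>UNIV. e$j * (int (D j) * B$j$l) * f$l)"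
  proof (intro sum.cong refl)
    fix l j
    show "- (B$l$j * e$j * int (D l) * f$l) = e$j * (int (D j) * B$j$l) * f$l"
      unfolding compatible_pair_DB_skew[OF assms, of j l] by simp
  qed
  also have "\<dots> = (\<Sum>j\<in>UNIV. \<Sum>l\<in>UNIV. e$j * (int (D j) * B$j$l) * f$l)" by (rule sum.swap)
  also have "of_int \<dots> = lattice_form (DB_matrix B D) e f"
    unfolding lattice_form_def DB_matrix_entry by simp
  finally show ?thesis .
qed

lemma half_exponents_DB_matrix: "half_exponents (DB_matrix B D) = range (\<lambda>m. of_int m / 2)"
proof -
  have "snd (quotient_of (DB_matrix B D $ i $ j)) = 1" for i j
    unfolding DB_matrix_entry quotient_of_rat_of_int by simp
  then have "{snd (quotient_of (DB_matrix B D $ i $ j)) |i j. True} = {1}" by simp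
  then have "common_denominator (DB_matrix B D) = 1" by (simp add: common_denominator_def)
  then show ?thesis by (simp add: half_exponents_def)
qed

subsection \<open>Mutation\<close>

text \<open>The involutions \<open>E\<close> and \<open>F\<close> of \<open>\<int>\<^sup>n\<close> for which the mutated matrix is \<open>E B F\<close>. The first acts on the
  exponents of the \<open>X\<^sub>i\<close>, the second on those of the \<open>Z\<^sub>i\<close>. Of the two admissible sign choices, this is the
  one for which \<open>E \<alpha>\<^sub>k\<close> is the second exponent in the exchange relation.\<close>

definition mutate_exponent :: "int^'n^'n \<Rightarrow> 'n \<Rightarrow> int^'n \<Rightarrow> int^('n::finite)" where
  "mutate_exponent B k g = (\<chi> i. if i = k then - g$k else g$i + max 0 (- B$i$k) * g$k)"

definition mutate_index :: "int^'n^'n \<Rightarrow> 'n \<Rightarrow> int^'n \<Rightarrow> int^('n::finite)" where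
  "mutate_index B k e = (\<chi> j. if j = k then - e$k + (\<Sum>l\<in>UNIV. max 0 (B$k$l) * e$l) else e$j)"

lemma mutate_exponent_add: "mutate_exponent B k (g + h) = mutate_exponent B k g + mutate_exponent B k h"
  by (simp add: mutate_exponent_def vec_eq_iff algebra_simps)

lemma mutate_exponent_minus: "mutate_exponent B k (- g) = - mutate_exponent B k g"
  by (simp add: mutate_exponent_def vec_eq_iff)

lemma mutate_exponent_involution: "mutate_exponent B k (mutate_exponent B k g) = g"
  by (simp add: mutate_exponent_def vec_eq_iff)

lemma mutate_exponent_axis: "i \<noteq> k \<Longrightarrow> mutate_exponent B k (axis i 1) = axis i 1"
  by (auto simp: mutate_exponent_def vec_eq_iff axis_def)

lemma mutation_exponent_entry:
  "mutation_exponent s B k $ i = (if i = k then -1 else 0) + max 0 (s (B$i$k))"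
proof -
  have "(\<Sum>l\<in>UNIV. max 0 (s (B$l$k)) *s axis l 1) $ i = (\<Sum>l\<in>UNIV. if l = i then max 0 (s (B$l$k)) else 0)"
    unfolding sum_component by (intro sum.cong refl) (simp add: axis_def)
  then show ?thesis by (simp add: mutation_exponent_def axis_def)
qed

context
  fixes M :: "rat^'n::finite^'n::finite" and B :: "int^'n::finite^'n::finite" and D :: "'n \<Rightarrow> nat" and k :: 'n
  assumes compat: "compatible_pair M B D"
begin

lemma diagonal_zero: "B$i$i = 0"
  using compatible_pair_DB_skew[OF compat, of i i] compatible_pair_pos[OF compat, of i] by simp

lemma mutation_exponent_uminus: "mutation_exponent uminus B k = mutate_exponent B k (axis k 1)"
  by (auto simp: vec_eq_iff mutation_exponent_entry mutate_exponent_def axis_def diagonal_zero)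

lemma mutation_exponent_id: "mutation_exponent (\<lambda>b. b) B k = - column k (mutate_matrix k B) + mutation_exponent uminus B k"
  by (auto simp: vec_eq_iff mutation_exponent_entry column_def mutate_matrix_def)

lemma mutate_index_involution: "mutate_index B k (mutate_index B k e) = e"
proof -
  have "(\<Sum>l\<in>UNIV. max 0 (B$k$l) * mutate_index B k e $ l) = (\<Sum>l\<in>UNIV. max 0 (B$k$l) * e$l)"
    by (intro sum.cong refl) (simp add: mutate_index_def diagonal_zero)
  then have "mutate_index B k (mutate_index B k e) $ i = e $ i" for i
    by (cases "i = k") (simp_all add: mutate_index_def)
  then show ?thesis by (simp add: vec_eq_iff)
qed

text \<open>The matrix factorisation \<open>E B' = B F\<close>. Entry by entry it reduces to
  \<open>sgn b [b c]\<^sub>+ = [- b]\<^sub>+ c + b [c]\<^sub>+\<close>.\<close>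

lemma mutate_exponent_mutate_matrix:
  "mutate_exponent B k (mutate_matrix k B *v e) = B *v mutate_index B k e"
proof -
  have split: "(B *v mutate_index B k e) $ i = (\<Sum>j\<in>UNIV. (if j = k then - B$i$k else B$i$j + B$i$k * max 0 (B$k$j)) * e$j)" for i
  proof -
    have "(B *v mutate_index B k e) $ i
      = (\<Sum>j\<in>UNIV. (if j = k then 0 else B$i$j * e$j) + (if j = k then B$i$k * (- e$k + (\<Sum>l\<in>UNIV. max 0 (B$k$l) * e$l)) else 0))"
      unfolding matrix_vector_mult_def by (simp, intro sum.cong refl) (simp add: mutate_index_def)
    also have "\<dots> = (\<Sum>j\<in>UNIV. if j = k then 0 else B$i$j * e$j) - B$i$k * e$k + (\<Sum>l\<in>UNIV. B$i$k * max 0 (B$k$l) * e$l)"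
      by (simp add: sum.distrib sum_distrib_left algebra_simps)
    also have "\<dots> = (\<Sum>j\<in>UNIV. (if j = k then 0 else B$i$j * e$j) - (if j = k then B$i$k * e$k else 0) + B$i$k * max 0 (B$k$j) * e$j)"
      by (simp add: sum.distrib sum_subtractf)
    also have "\<dots> = (\<Sum>j\<in>UNIV. (if j = k then - B$i$k else B$i$j + B$i$k * max 0 (B$k$j)) * e$j)"
      by (intro sum.cong refl) (simp add: diagonal_zero distrib_right)
    finally show ?thesis .
  qed
  have row: "(mutate_matrix k B *v e) $ k = (\<Sum>j\<in>UNIV. - B$k$j * e$j)"
    by (simp add: matrix_vector_mult_def mutate_matrix_def)
  have "mutate_exponent B k (mutate_matrix k B *v e) $ i = (B *v mutate_index B k e) $ i" for i
  proof (cases "i = k")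
    case True
    have "mutate_exponent B k (mutate_matrix k B *v e) $ k = (\<Sum>j\<in>UNIV. B$k$j * e$j)"
      by (simp add: mutate_exponent_def row sum_negf)
    also have "\<dots> = (B *v mutate_index B k e) $ k"
      unfolding split by (intro sum.cong refl) (simp add: diagonal_zero)
    finally show ?thesis using True by simp
  next
    case False
    have "mutate_exponent B k (mutate_matrix k B *v e) $ i
      = (\<Sum>j\<in>UNIV. mutate_matrix k B $ i $ j * e$j) + max 0 (- B$i$k) * (\<Sum>j\<in>UNIV. - B$k$j * e$j)"
      using False by (simp add: mutate_exponent_def row) (simp add: matrix_vector_mult_def)
    also have "\<dots> = (\<Sum>j\<in>UNIV. (mutate_matrix k B $ i $ j - max 0 (- B$i$k) * B$k$j) * e$j)"
      by (simp add: sum_distrib_left sum.distrib[symmetric] algebra_simps)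
    also have "\<dots> = (B *v mutate_index B k e) $ i"
      unfolding split
    proof (intro sum.cong refl arg_cong2[where f = "(*)"])
      fix j
      show "mutate_matrix k B $ i $ j - max 0 (- B$i$k) * B$k$j = (if j = k then - B$i$k else B$i$j + B$i$k * max 0 (B$k$j))"
      proof (cases "j = k")
        case False
        have "sgn b * max 0 (b * c) - max 0 (- b) * c = b * max 0 c" for b c :: int
          by (cases "b > 0"; cases "b = 0"; cases "c \<ge> 0")
            (simp_all add: max_def mult_le_0_iff zero_le_mult_iff not_less not_le)
        from this[of "B$i$k" "B$k$j"] show ?thesis
          using False \<open>i \<noteq> k\<close> by (simp add: mutate_matrix_def)
      qed (simp add: mutate_matrix_def diagonal_zero)
    qed
    finally show ?thesis .
  qed
  then show ?thesis by (simp add: vec_eq_iff)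
qed

lemma mutate_exponent_matrix:
  "mutate_exponent B k (B *v e) = mutate_matrix k B *v mutate_index B k e"
proof -
  have "mutate_exponent B k (B *v e)
      = mutate_exponent B k (mutate_exponent B k (mutate_matrix k B *v mutate_index B k e))"
    by (simp only: mutate_exponent_mutate_matrix mutate_index_involution)
  then show ?thesis by (simp only: mutate_exponent_involution)
qed

lemma lattice_form_additive_matrix:
  fixes T :: "int^'n \<Rightarrow> int^'n"
  assumes add: "\<And>a b. T (a + b) = T a + T b" and minus: "\<And>a. T (- a) = - T a"
  shows "lattice_form (\<chi> i j. lattice_form M (T (axis i 1)) (T (axis j 1))) a b = lattice_form M (T a) (T b)"
proof -
  let ?N = "\<chi> i j. lattice_form M (T (axis i 1)) (T (axis j 1))"
  have "lattice_form ?N (axis i 1) b = lattice_form M (T (axis i 1)) (T b)" for i b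
    by (induction b rule: vec_int_induct)
      (simp_all add: lattice_form_axis lattice_form_add_right lattice_form_minus_right add minus)
  then show ?thesis
    by (induction a rule: vec_int_induct) (simp_all add: lattice_form_add_left lattice_form_minus_left add minus)
qed

text \<open>The transported form \<open>N(a, b) = \<Lambda>(E a, E b)\<close> satisfies \<open>N B' = - D\<close>, because
  \<open>N(\<alpha>\<^sub>i, B' \<alpha>\<^sub>j) = \<Lambda>(E \<alpha>\<^sub>i, B F \<alpha>\<^sub>j)\<close> and \<open>E\<close>, \<open>F\<close> are involutions adjoint to each other with respect to \<open>D\<close>. As a compatible pair
  determines its form, \<open>N\<close> is the \<open>\<Lambda>\<close> of the mutated quiver.\<close>

lemma
  shows compatible_pair_mutate:
    "compatible_pair (Lambda_matrix (mutate_matrix k B) D) (mutate_matrix k B) D"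
    and lattice_form_mutate_exponent:
    "lattice_form (Lambda_matrix (mutate_matrix k B) D) (mutate_exponent B k g) (mutate_exponent B k h) = lattice_form M g h"
proof -
  let ?E = "mutate_exponent B k" and ?B = "mutate_matrix k B"
  define N where "N = (\<chi> i j. lattice_form M (?E (axis i 1)) (?E (axis j 1)))"
  have lattice_form_N: "lattice_form N a b = lattice_form M (?E a) (?E b)" for a b
    unfolding N_def by (rule lattice_form_additive_matrix[OF mutate_exponent_add mutate_exponent_minus])
  have "N$i$j = - N$j$i" for i j
    unfolding N_def using lattice_form_swap[OF compatible_pair_skew[OF compat], of "?E (axis i 1)" "?E (axis j 1)"] by simp
  moreover have "(\<Sum>l\<in>UNIV. N$i$l * of_int (?B$l$j)) = (if i = j then - of_nat (D i) else 0)" for i j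
  proof -
    let ?e = "axis j 1 :: int^'n"
    have "(\<Sum>l\<in>UNIV. N$i$l * of_int (?B$l$j)) = lattice_form N (axis i 1) (?B *v ?e)"
    proof -
      have "lattice_form N (axis i 1) (?B *v ?e) = (\<Sum>i'\<in>UNIV. if i' = i then (\<Sum>l\<in>UNIV. N$i'$l * of_int (?B$l$j)) else 0)"
        unfolding lattice_form_def matrix_vector_axis_entry by (intro sum.cong refl) (simp add: axis_def)
      then show ?thesis by simp
    qed
    also have "\<dots> = lattice_form M (?E (axis i 1)) (B *v mutate_index B k ?e)"
      unfolding lattice_form_N mutate_exponent_mutate_matrix ..
    also have "\<dots> = - of_int (\<Sum>l\<in>UNIV. ?E (axis i 1)$l * int (D l) * mutate_index B k ?e$l)"
      by (rule lattice_form_matrix_vector_mult[OF compat])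
    also have "(\<Sum>l\<in>UNIV. ?E (axis i 1)$l * int (D l) * mutate_index B k ?e$l) = (if i = j then int (D i) else 0)"
    proof (cases "i = k")
      case False
      have "(\<Sum>l\<in>UNIV. ?E (axis i 1)$l * int (D l) * mutate_index B k ?e$l)
        = (\<Sum>l\<in>UNIV. if l = i then int (D i) * mutate_index B k ?e$i else 0)"
        unfolding mutate_exponent_axis[OF False] by (intro sum.cong refl) (simp add: axis_def)
      then show ?thesis using False by (simp add: mutate_index_def axis_def)
    next
      case True
      have Fk: "mutate_index B k ?e$k = (if j = k then - 1 else max 0 (B$k$j))"
      proof -
        have "(\<Sum>l\<in>UNIV. max 0 (B$k$l) * ?e$l) = (\<Sum>l\<in>UNIV. if l = j then max 0 (B$k$l) else 0)"
          by (intro sum.cong refl) (simp add: axis_def)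
        then show ?thesis by (simp add: mutate_index_def axis_def diagonal_zero)
      qed
      have "(\<Sum>l\<in>UNIV. ?E (axis k 1)$l * int (D l) * mutate_index B k ?e$l)
        = (\<Sum>l\<in>UNIV. (if l = k then - int (D k) * mutate_index B k ?e$k else 0)
            + (if l = j then (if j = k then 0 else max 0 (- B$j$k) * int (D j)) else 0))"
        by (intro sum.cong refl) (auto simp: mutate_exponent_def mutate_index_def axis_def)
      also have "\<dots> = - int (D k) * mutate_index B k ?e$k + (if j = k then 0 else max 0 (- B$j$k) * int (D j))"
        by (simp add: sum.distrib)
      also have "\<dots> = (if k = j then int (D k) else 0)"
      proof (cases "j = k")
        case False
        have "max 0 (- B$j$k) * int (D j) = max 0 (int (D j) * - B$j$k)"
          by (simp add: max_def mult_le_0_iff zero_le_mult_iff compatible_pair_pos[OF compat] mult.commute)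
        also have "int (D j) * - B$j$k = int (D k) * B$k$j"
          using compatible_pair_DB_skew[OF compat, of j k] by simp
        also have "max 0 \<dots> = int (D k) * max 0 (B$k$j)"
          by (simp add: max_def zero_le_mult_iff mult_le_0_iff compatible_pair_pos[OF compat])
        finally show ?thesis using False by (simp add: Fk)
      next
        case True
        then show ?thesis using Fk by simp
      qed
      finally show ?thesis using True by simp
    qed
    finally show ?thesis by simp
  qed
  ultimately have N: "compatible_pair N ?B D"
    using compat unfolding compatible_pair_def by blast
  then have Lambda: "Lambda_matrix ?B D = N" by (rule Lambda_matrix_eqI)
  show "compatible_pair (Lambda_matrix ?B D) ?B D" using N Lambda by simp
  show "lattice_form (Lambda_matrix ?B D) (?E g) (?E h) = lattice_form M g h"
    unfolding Lambda lattice_form_N mutate_exponent_involution ..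
qed

end

section \<open>The embedding of the F-factors\<close>

lemma matrix_vector_mult_minus_right: "B *v (- a) = - (B *v a :: int^'n)"
  by (simp add: matrix_vector_mult_def vec_eq_iff sum_negf)

lemma half_exponents_DB_subset: "half_exponents (DB_matrix B D) \<subseteq> half_exponents (M :: rat^'n::finite^'n)"
  unfolding half_exponents_DB_matrix by (auto intro: half_exponents_half_int)

locale DB_embedding =
  fixes q :: "'k::field" and qp :: "rat \<Rightarrow> 'k"
    and B :: "int^'n::{finite,linorder}^'n::{finite,linorder}" and D :: "'n \<Rightarrow> nat"
    and \<iota> :: "('n, 'k, 'f::division_ring) torus_map" and \<iota>Z :: "('n, 'k, 'g::division_ring) torus_map"
    and j :: "'g \<Rightarrow> 'f"
  assumes powers: "rational_powers q qp"
    and fraction_field: "is_skew_fraction_field (quantum_torus qp (Lambda_matrix B D)) \<iota>"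
    and fraction_field_Z: "is_skew_fraction_field (quantum_torus qp (DB_matrix B D)) \<iota>Z"
    and compat: "compatible_pair (Lambda_matrix B D) B D"
    and embedding: "is_DB_embedding qp B D \<iota>Z \<iota> j"

sublocale DB_embedding \<subseteq> X: quantum_torus_field q qp "Lambda_matrix B D" \<iota>
  by unfold_locales (rule powers fraction_field compatible_pair_skew[OF compat])+

sublocale DB_embedding \<subseteq> Z: quantum_torus_field q qp "DB_matrix B D" \<iota>Z
  by unfold_locales (rule powers fraction_field_Z DB_matrix_skew[OF compat])+

lemma ring_hom_of_type_algebra:
  assumes "h \<in> ring_hom (ring_of_type_algebra :: 'a::division_ring ring) (ring_of_type_algebra :: 'b::division_ring ring)"
  shows "h (x + y) = h x + h y" "h (x * y) = h x * h y" "h 1 = 1" "h 0 = 0" "h (inverse x) = inverse (h x)"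
    "h (of_nat m) = of_nat m"
proof -
  show add: "h (x + y) = h x + h y" for x y using ring_hom_add[OF assms, of x y] by simp
  show mult: "h (x * y) = h x * h y" for x y using ring_hom_mult[OF assms, of x y] by simp
  show one: "h 1 = 1" using ring_hom_one[OF assms] by simp
  show zero: "h 0 = 0" using add[of 0 0] by simp
  show "h (inverse x) = inverse (h x)"
  proof (cases "x = 0")
    case False
    then have "h x * h (inverse x) = 1" using mult[of x "inverse x"] one by simp
    then show ?thesis by (rule inverse_unique[symmetric])
  qed (simp add: zero)
  show "h (of_nat m) = of_nat m" by (induction m) (simp_all add: zero one add)
qed

context DB_embedding
begin

lemma j_ring_hom: "j \<in> ring_hom ring_of_type_algebra ring_of_type_algebra"
  using embedding unfolding is_DB_embedding_def by blast

lemmas j_hom = ring_hom_of_type_algebra[OF j_ring_hom]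

lemma base_ring_subset: "Z.R \<subseteq> X.R"
  by (rule base_ring_mono[OF powers half_exponents_DB_subset])

lemma j_scal: "r \<in> Z.R \<Longrightarrow> j (Z.scal r) = X.scal r"
  using embedding unfolding is_DB_embedding_def by blast

lemma j_qscal: "r \<in> half_exponents (DB_matrix B D) \<Longrightarrow> j (Z.qscal r) = X.qscal r"
  by (rule j_scal[OF base_ring_exponent[OF powers]])

lemma j_gen: "j (Z.gen i) = X.monomial (B *v axis i 1)"
proof -
  have "B *v axis i 1 = column i B"
    by (simp add: vec_eq_iff matrix_vector_axis_entry column_def)
  then show ?thesis using embedding unfolding is_DB_embedding_def by simp
qed

text \<open>Both sides are multiplicative with the same cocycle and agree on the \<open>Z\<^sub>i\<close>.\<close>

lemma j_monomial: "j (Z.monomial e) = X.monomial (B *v e)"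
proof (induction e rule: vec_int_induct)
  case (axis i)
  show ?case by (simp only: Z.monomial_axis j_gen)
next
  case (add a b)
  let ?r = "lattice_form (DB_matrix B D) a b / 2"
  have r: "?r \<in> half_exponents (DB_matrix B D)" by (rule half_exponents_half_lattice_form)
  have r': "?r \<in> half_exponents (Lambda_matrix B D)" using r half_exponents_DB_subset by blast
  have "j (Z.monomial a * Z.monomial b) = j (Z.qscal ?r * Z.monomial (a + b))" by (simp only: Z.monomial_mult)
  then have "X.monomial (B *v a) * X.monomial (B *v b) = X.qscal ?r * j (Z.monomial (a + b))"
    by (simp only: j_hom add j_qscal[OF r])
  moreover have "X.monomial (B *v a) * X.monomial (B *v b) = X.qscal ?r * X.monomial (B *v (a + b))"
    by (simp only: X.monomial_mult lattice_form_DB_matrix[OF compat] matrix_vector_right_distrib)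
  ultimately show ?case using X.qscal_nonzero[OF r'] by simp
next
  case (minus a)
  have "j (Z.monomial (- a)) = inverse (X.monomial (B *v a))"
    by (simp only: Z.inverse_monomial[symmetric] j_hom minus)
  also have "\<dots> = X.monomial (B *v (- a))"
    by (simp only: X.inverse_monomial matrix_vector_mult_minus_right)
  finally show ?case .
qed

lemma int_exponent: "of_int m \<in> half_exponents (DB_matrix B D)"
  by (rule half_exponents_int)

text \<open>\<open>X\<^sup>(\<^sup>g\<^sup>)\<close> commutes with \<open>j(Z\<^sub>i)\<close> up to \<open>q\<close> to the \<open>- d\<^sub>i g\<^sub>i\<close>, which is a scalar of the \<open>Z\<close>-torus; the property
  then extends to the skew field generated by the \<open>Z\<^sub>i\<close>.\<close>

lemma monomial_normalises: "\<exists>c'. X.monomial g * j c = j c' * X.monomial g"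
proof (induction c rule: Z.division_ring_induct)
  case (scal r)
  have "X.monomial g * j (Z.scal r) = j (Z.scal r) * X.monomial g"
    unfolding j_scal[OF scal] using scal base_ring_subset by (intro X.scal_central[symmetric]) blast
  then show ?case by blast
next
  case (gen i)
  obtain m where m: "lattice_form (Lambda_matrix B D) g (B *v axis i 1) = of_int m"
    unfolding lattice_form_matrix_vector_mult[OF compat] by (metis of_int_minus)
  have "X.monomial g * j (Z.gen i) = X.qscal (of_int m) * (X.monomial (B *v axis i 1) * X.monomial g)"
    unfolding j_gen by (subst X.monomial_commute) (simp only: m)
  also have "\<dots> = j (Z.qscal (of_int m) * Z.gen i) * X.monomial g"
    by (simp only: j_hom j_qscal[OF int_exponent] j_gen mult.assoc)
  finally show ?case by blast
next
  case (add x y)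
  then obtain x' y' where "X.monomial g * j x = j x' * X.monomial g" "X.monomial g * j y = j y' * X.monomial g" by blast
  then have "X.monomial g * j (x + y) = j (x' + y') * X.monomial g" by (simp add: j_hom distrib_left distrib_right)
  then show ?case by blast
next
  case (mult x y)
  then obtain x' y' where x: "X.monomial g * j x = j x' * X.monomial g" and y: "X.monomial g * j y = j y' * X.monomial g" by blast
  have "X.monomial g * j (x * y) = (X.monomial g * j x) * j y" by (simp only: j_hom mult.assoc)
  also have "\<dots> = j x' * (X.monomial g * j y)" by (simp only: x mult.assoc)
  also have "\<dots> = j (x' * y') * X.monomial g" by (simp only: y j_hom mult.assoc)
  finally show ?case by blast
next
  case (inverse x)
  then obtain x' where x: "X.monomial g * j x = j x' * X.monomial g" by blast
  show ?case
  proof (cases "j x = 0")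
    case True
    then have "X.monomial g * j (inverse x) = j 0 * X.monomial g" by (simp add: j_hom)
    then show ?thesis by blast
  next
    case False
    then have "X.monomial g * j x \<noteq> 0" using X.monomial_nonzero by simp
    then have x': "j x' \<noteq> 0" unfolding x by auto
    have "inverse (j x') * (X.monomial g * j x) * inverse (j x) = inverse (j x') * (j x' * X.monomial g) * inverse (j x)"
      by (simp only: x)
    then have "inverse (j x') * X.monomial g * (j x * inverse (j x)) = (inverse (j x') * j x') * (X.monomial g * inverse (j x))"
      by (simp only: mult.assoc)
    then have "X.monomial g * j (inverse x) = j (inverse x') * X.monomial g"
      using False x' by (simp add: j_hom)
    then show ?thesis by blast
  qed
qed

end

section \<open>Mutation of compatible elements\<close>

locale mutation =
  P: DB_embedding q qp B D \<iota> \<iota>Z j + P': DB_embedding q qp "mutate_matrix k B" D \<iota>' \<iota>Z' j'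
  for q :: "'k::field" and qp :: "rat \<Rightarrow> 'k"
    and B :: "int^'n::{finite,linorder}^'n::{finite,linorder}" and D :: "'n \<Rightarrow> nat"
    and \<iota> :: "('n, 'k, 'f::division_ring) torus_map" and \<iota>Z :: "('n, 'k, 'g::division_ring) torus_map"
    and j :: "'g \<Rightarrow> 'f" and k :: 'n
    and \<iota>' :: "('n, 'k, 'f'::division_ring) torus_map" and \<iota>Z' :: "('n, 'k, 'g'::division_ring) torus_map"
    and j' :: "'g' \<Rightarrow> 'f'" +
  fixes \<mu> :: "'f \<Rightarrow> 'f'"
  assumes mutation: "is_mutation qp B D k \<iota> \<iota>' \<mu>"
begin

lemma mu_ring_hom: "\<mu> \<in> ring_hom ring_of_type_algebra ring_of_type_algebra"
  using mutation unfolding is_mutation_def Let_def ring_iso_def by blast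

lemmas mu_hom = ring_hom_of_type_algebra[OF mu_ring_hom]

lemma mu_scal: "r \<in> P.X.R \<Longrightarrow> \<mu> (P.X.scal r) = P'.X.scal r"
  using mutation unfolding is_mutation_def Let_def by blast

lemma mu_gen: "i \<noteq> k \<Longrightarrow> \<mu> (P.X.gen i) = P'.X.gen i"
  using mutation unfolding is_mutation_def Let_def by blast

lemma mu_gen_k: "\<mu> (P.X.gen k) = P'.X.monomial (mutation_exponent (\<lambda>b. b) B k) + P'.X.monomial (mutation_exponent uminus B k)"
  using mutation unfolding is_mutation_def Let_def by blast

text \<open>The two exponents in the exchange relation differ by \<open>- B' \<alpha>\<^sub>k\<close>, so the sum of the two monomials is a
  binomial in \<open>j'(Z'\<^sub>k\<^sup>-\<^sup>1)\<close> times the second monomial.\<close>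

lemma mu_gen_k_factor:
  "\<exists>c. \<mu> (P.X.gen k) = j' c * P'.X.monomial (mutate_exponent B k (axis k 1))"
proof -
  let ?B = "mutate_matrix k B" and ?a = "mutate_exponent B k (axis k 1)"
  let ?L = "Lambda_matrix ?B D" and ?e = "- axis k 1 :: int^'n::{finite,linorder}"
  have a: "mutation_exponent uminus B k = ?a"
    by (rule mutation_exponent_uminus[OF P.compat])
  have col: "?B *v ?e = - column k ?B"
    by (simp add: vec_eq_iff matrix_vector_mult_minus_right matrix_vector_axis_entry column_def)
  have b: "mutation_exponent (\<lambda>b. b) B k = ?B *v ?e + ?a"
    unfolding mutation_exponent_id[OF P.compat] a col ..
  obtain m where m: "lattice_form ?L (?B *v ?e) ?a = of_int m"
  proof -
    have "lattice_form ?L (?B *v ?e) ?a = - lattice_form ?L ?a (?B *v ?e)"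
      by (rule lattice_form_swap) (rule compatible_pair_skew[OF P'.compat])
    also have "\<dots> = of_int (\<Sum>l\<in>UNIV. ?a$l * int (D l) * ?e$l)"
      unfolding lattice_form_matrix_vector_mult[OF P'.compat] by (rule minus_minus)
    finally show ?thesis using that by blast
  qed
  let ?r = "of_int m / 2 :: rat"
  have r: "- ?r \<in> half_exponents (DB_matrix ?B D)"
    by (intro half_exponents_minus half_exponents_half_int)
  have r': "?r \<in> half_exponents ?L" by (rule half_exponents_half_int)
  have "P'.X.monomial (?B *v ?e) * P'.X.monomial ?a = P'.X.qscal ?r * P'.X.monomial (?B *v ?e + ?a)"
    by (simp only: P'.X.monomial_mult m)
  then have "P'.X.qscal (- ?r) * (P'.X.monomial (?B *v ?e) * P'.X.monomial ?a) = P'.X.monomial (?B *v ?e + ?a)"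
    by (simp only: mult.assoc[symmetric] P'.X.qscal_minus[OF r'] mult_1_left)
  then have "\<mu> (P.X.gen k) = P'.X.qscal (- ?r) * P'.X.monomial (?B *v ?e) * P'.X.monomial ?a + P'.X.monomial ?a"
    unfolding mu_gen_k a b by (simp only: mult.assoc)
  also have "\<dots> = j' (P'.Z.qscal (- ?r) * P'.Z.monomial ?e + 1) * P'.X.monomial ?a"
    by (simp only: P'.j_hom P'.j_qscal[OF r] P'.j_monomial distrib_right mult_1_left)
  finally show ?thesis by blast
qed

text \<open>Under addition of exponents the two cocycles \<open>q\<close> to the \<open>\<Lambda>(a, b) / 2\<close> and to the \<open>\<Lambda>'(E a, E b) / 2\<close> cancel;
  without this cancellation a fractional power of \<open>q\<close> outside the image of \<open>j'\<close> could remain.\<close>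

lemma mu_monomial: "\<exists>c. \<mu> (P.X.monomial g) = j' c * P'.X.monomial (mutate_exponent B k g)"
proof (induction g rule: vec_int_induct)
  case (axis i)
  show ?case
  proof (cases "i = k")
    case True
    then show ?thesis using mu_gen_k_factor by (simp only: P.X.monomial_axis)
  next
    case False
    have "\<mu> (P.X.monomial (axis i 1)) = j' 1 * P'.X.monomial (mutate_exponent B k (axis i 1))"
      unfolding P.X.monomial_axis mu_gen[OF False] mutate_exponent_axis[OF False] P'.X.monomial_axis P'.j_hom by simp
    then show ?thesis by blast
  qed
next
  case (add a b)
  let ?E = "mutate_exponent B k"
  obtain c d where c: "\<mu> (P.X.monomial a) = j' c * P'.X.monomial (?E a)" and d: "\<mu> (P.X.monomial b) = j' d * P'.X.monomial (?E b)"
    using add by blast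
  \<comment> \<open>Moves the factor of \<open>\<mu> (X\<^sup>(\<^sup>b\<^sup>))\<close> from the image of \<open>j'\<close> past the monomial of \<open>\<mu> (X\<^sup>(\<^sup>a\<^sup>))\<close>.\<close>
  obtain d' where d': "P'.X.monomial (?E a) * j' d = j' d' * P'.X.monomial (?E a)"
    using P'.monomial_normalises by blast
  let ?r = "lattice_form (Lambda_matrix B D) a b / 2"
  have r: "?r \<in> half_exponents (Lambda_matrix B D)" by (rule half_exponents_half_lattice_form)
  have lattice_form: "lattice_form (Lambda_matrix (mutate_matrix k B) D) (?E a) (?E b) = lattice_form (Lambda_matrix B D) a b"
    by (rule lattice_form_mutate_exponent[OF P.compat])
  have r': "?r \<in> half_exponents (Lambda_matrix (mutate_matrix k B) D)"
    unfolding lattice_form[symmetric] by (rule half_exponents_half_lattice_form)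
  have "P'.X.qscal ?r * \<mu> (P.X.monomial (a + b)) = \<mu> (P.X.qscal ?r * P.X.monomial (a + b))"
    by (simp only: mu_hom mu_scal[OF base_ring_exponent[OF P.powers r]])
  also have "\<dots> = j' c * (P'.X.monomial (?E a) * j' d) * P'.X.monomial (?E b)"
    by (simp only: P.X.monomial_mult[symmetric] mu_hom c d mult.assoc)
  also have "\<dots> = j' (c * d') * (P'.X.monomial (?E a) * P'.X.monomial (?E b))"
    by (simp only: d' P'.j_hom mult.assoc)
  also have "\<dots> = j' (c * d') * (P'.X.qscal ?r * P'.X.monomial (?E (a + b)))"
    by (simp only: P'.X.monomial_mult lattice_form mutate_exponent_add)
  also have "\<dots> = P'.X.qscal ?r * (j' (c * d') * P'.X.monomial (?E (a + b)))"
    by (rule P'.X.qscal_left_commute[OF r'])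
  finally have "\<mu> (P.X.monomial (a + b)) = j' (c * d') * P'.X.monomial (?E (a + b))"
    using P'.X.qscal_nonzero[OF r'] by simp
  then show ?case by blast
next
  case (minus a)
  let ?E = "mutate_exponent B k"
  obtain c where c: "\<mu> (P.X.monomial a) = j' c * P'.X.monomial (?E a)" using minus by blast
  have nz: "j' c \<noteq> 0"
  proof
    assume "j' c = 0"
    then have "\<mu> (P.X.monomial a * P.X.monomial (- a)) = 0" by (simp add: mu_hom c)
    then show False by (simp add: P.X.monomial_minus mu_hom)
  qed
  \<comment> \<open>Inverting a product reverses it, so the monomial has to be moved back to the right.\<close>
  obtain c' where c': "P'.X.monomial (- ?E a) * j' (inverse c) = j' c' * P'.X.monomial (- ?E a)"
    using P'.monomial_normalises by blast
  have "\<mu> (P.X.monomial (- a)) = inverse (j' c * P'.X.monomial (?E a))"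
    by (simp only: P.X.inverse_monomial[symmetric] mu_hom c)
  also have "\<dots> = P'.X.monomial (- ?E a) * j' (inverse c)"
    by (simp only: nonzero_inverse_mult_distrib[OF nz P'.X.monomial_nonzero] P'.X.inverse_monomial P'.j_hom)
  finally have "\<mu> (P.X.monomial (- a)) = j' c' * P'.X.monomial (?E (- a))"
    by (simp only: c' mutate_exponent_minus)
  then show ?case by blast
qed

text \<open>The image of \<open>j'\<close> is a skew field, so only the scalars and the \<open>Z\<^sub>i\<close> have to be examined. For \<open>Z\<^sub>i\<close> the
  monomial of \<open>mu_monomial\<close> has exponent \<open>E B \<alpha>\<^sub>i = B' F \<alpha>\<^sub>i\<close> and lies in the image of \<open>j'\<close> as well.\<close>

lemma mu_range_j: "\<exists>c. \<mu> (j z) = j' c"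
proof (induction z rule: P.Z.division_ring_induct)
  case (scal r)
  have r: "r \<in> P.X.R" using scal P.base_ring_subset by blast
  have r': "r \<in> P'.Z.R"
    using scal base_ring_mono[OF P.powers half_exponents_DB_subset] by blast
  have "\<mu> (j (P.Z.scal r)) = j' (P'.Z.scal r)"
    by (simp only: P.j_scal[OF scal] mu_scal[OF r] P'.j_scal[OF r'])
  then show ?case by blast
next
  case (gen i)
  obtain c where "\<mu> (j (P.Z.gen i)) = j' c * P'.X.monomial (mutate_exponent B k (B *v axis i 1))"
    using mu_monomial unfolding P.j_gen by blast
  then have "\<mu> (j (P.Z.gen i)) = j' (c * P'.Z.monomial (mutate_index B k (axis i 1)))"
    by (simp only: mutate_exponent_matrix[OF P.compat] P'.j_hom P'.j_monomial)
  then show ?case by blast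
next
  case (add x y)
  then show ?case by (metis P.j_hom(1) P'.j_hom(1) mu_hom(1))
next
  case (mult x y)
  then show ?case by (metis P.j_hom(2) P'.j_hom(2) mu_hom(2))
next
  case (inverse x)
  then show ?case by (metis P.j_hom(5) P'.j_hom(5) mu_hom(5))
qed

lemma mutation_preserves_compatibility:
  assumes "B_compatible qp B D \<iota> j x"
  shows "B_compatible qp (mutate_matrix k B) D \<iota>' j' (\<mu> x)"
proof -
  obtain F g where x: "x = j F * P.X.monomial g"
    using assms unfolding B_compatible_def is_F_factor_def by blast
  obtain c d where "\<mu> (j F) = j' c" "\<mu> (P.X.monomial g) = j' d * P'.X.monomial (mutate_exponent B k g)"
    using mu_range_j mu_monomial by blast
  then have "\<mu> x = j' (c * d) * P'.X.monomial (mutate_exponent B k g)"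
    by (simp only: x mu_hom P'.j_hom mult.assoc)
  then show ?thesis unfolding B_compatible_def is_F_factor_def by blast
qed

end

section \<open>Dimensions of subspaces\<close>

context vectorspace
begin

lemma subspace_basis:
  assumes fd: "fin_dim" and W: "VectorSpace.subspace K W V"
  obtains \<beta> where "finite \<beta>" "\<beta> \<subseteq> W" "lin_indpt \<beta>" "span \<beta> = W" "vectorspace.dim K (vs W) = card \<beta>"
proof -
  interpret W: vectorspace K "vs W" by (rule subspace_is_vs[OF W])
  have sub: "submodule K W V" using W by (simp add: VectorSpace.subspace_def)
  have WV: "W \<subseteq> carrier V" using sub by (simp add: submodule_def)
  have indpt: "W.lin_dep S = lin_dep S" and span: "W.span S = span S" if "S \<subseteq> W" for S
    using span_li_not_depend[OF that sub] by simp_all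
  have "finite S \<and> card S \<le> dim" if "S \<subseteq> carrier (vs W) \<and> W.lin_indpt S" for S
    using that indpt WV li_le_dim[OF fd, of S] by auto
  moreover have "{} \<subseteq> carrier (vs W) \<and> W.lin_indpt {}"
    by (simp add: W.lin_dep_def)
  ultimately obtain \<beta> where \<beta>: "finite \<beta>" "maximal \<beta> (\<lambda>S. S \<subseteq> carrier (vs W) \<and> W.lin_indpt S)"
    using maximal_exists[of "\<lambda>S. S \<subseteq> carrier (vs W) \<and> W.lin_indpt S" dim "{}"] by blast
  have basis: "W.basis \<beta>" by (rule W.max_li_is_basis[OF \<beta>(2)])
  then have "\<beta> \<subseteq> W" "W.lin_indpt \<beta>" "W.span \<beta> = W" by (auto simp: W.basis_def)
  then show ?thesis
    using that[of \<beta>] \<beta>(1) W.dim_basis[OF \<beta>(1) basis] indpt span by simp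
qed

lemma subspace_dim_le:
  assumes "fin_dim" "VectorSpace.subspace K W V"
  shows "vectorspace.dim K (vs W) \<le> dim"
proof -
  obtain \<beta> where \<beta>: "\<beta> \<subseteq> W" "lin_indpt \<beta>" "vectorspace.dim K (vs W) = card \<beta>"
    using subspace_basis[OF assms] by metis
  have "\<beta> \<subseteq> carrier V" using \<beta>(1) assms(2) by (auto simp: VectorSpace.subspace_def submodule_def)
  then show ?thesis using li_le_dim(2)[OF assms(1)] \<beta> by simp
qed

lemma subspace_dim_zero:
  assumes "fin_dim" "VectorSpace.subspace K W V" "vectorspace.dim K (vs W) = 0"
  shows "W = {\<zero>\<^bsub>V\<^esub>}"
proof -
  obtain \<beta> where \<beta>: "finite \<beta>" "span \<beta> = W" "vectorspace.dim K (vs W) = card \<beta>"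
    using subspace_basis[OF assms(1,2)] by metis
  then have "\<beta> = {}" using assms(3) by simp
  then show ?thesis using \<beta>(2) span_empty by simp
qed

lemma zero_subspace: "VectorSpace.subspace K {\<zero>\<^bsub>V\<^esub>} V"
  using span_is_submodule[of "{}"] by (simp add: span_empty VectorSpace.subspace_def vectorspace_axioms)

lemma dim_zero_subspace: "vectorspace.dim K (vs {\<zero>\<^bsub>V\<^esub>}) = 0"
proof -
  interpret Z: vectorspace K "vs {\<zero>\<^bsub>V\<^esub>}" by (rule subspace_is_vs[OF zero_subspace])
  have "Z.span {} = carrier (vs {\<zero>\<^bsub>V\<^esub>})" using Z.span_empty by simp
  then show ?thesis using Z.gen_ge_dim[of "{}"] by simp
qed

end

section \<open>The quiver Grassmannians\<close>

lemma valued_rep_vectorspace: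
  assumes "is_valued_rep B D L K V \<phi>"
  shows "vectorspace (degree_extension L K (D i)) (V i)"
    and "vectorspace.fin_dim (degree_extension L K (D i)) (V i)"
  using assms unfolding is_valued_rep_def by blast+

text \<open>This yields the constant term \<open>1\<close> of the \<open>F\<close>-factor.\<close>

lemma quiver_grassmannian_zero:
  assumes rep: "is_valued_rep B D L K V \<phi>"
  shows "quiver_grassmannian B D L K V \<phi> 0 = {\<lambda>i. {\<zero>\<^bsub>V i\<^esub>}}"
proof (rule Set.set_eqI, rule iffI)
  fix W assume W: "W \<in> quiver_grassmannian B D L K V \<phi> 0"
  have "W i = {\<zero>\<^bsub>V i\<^esub>}" for i
  proof (rule vectorspace.subspace_dim_zero[OF valued_rep_vectorspace[OF rep]])
    show "VectorSpace.subspace (degree_extension L K (D i)) (W i) (V i)"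
      using W by (simp add: quiver_grassmannian_def)
    have "dim_vector D L K (\<lambda>i. (V i)\<lparr>carrier := W i\<rparr>) $ i = 0"
      using W by (simp add: quiver_grassmannian_def)
    then show "vectorspace.dim (degree_extension L K (D i)) ((V i)\<lparr>carrier := W i\<rparr>) = 0"
      by (simp add: dim_vector_def)
  qed
  then show "W \<in> {\<lambda>i. {\<zero>\<^bsub>V i\<^esub>}}" by auto
next
  fix W assume "W \<in> {\<lambda>i. {\<zero>\<^bsub>V i\<^esub>}}"
  then have W: "W = (\<lambda>i. {\<zero>\<^bsub>V i\<^esub>})" by simp
  have "\<phi> i j m \<zero>\<^bsub>V i\<^esub> = \<zero>\<^bsub>V j\<^esub>" if "is_arrow B i j m" for i j m
  proof -
    interpret linear_map "degree_extension L K (gcd (D i) (D j))" "V i" "V j" "\<phi> i j m"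
      using rep that unfolding is_valued_rep_def by blast
    show ?thesis by (rule f0_is_0)
  qed
  then show "W \<in> quiver_grassmannian B D L K V \<phi> 0"
    unfolding quiver_grassmannian_def W
    by (simp add: vectorspace.zero_subspace[OF valued_rep_vectorspace(1)[OF rep]]
        dim_vector_def vectorspace.dim_zero_subspace[OF valued_rep_vectorspace(1)[OF rep]] vec_eq_iff)
qed

lemma finite_bounded_vectors: "finite {e :: int^'n::finite. \<forall>i. 0 \<le> e$i \<and> e$i \<le> N i}"
proof -
  have "{e :: int^'n. \<forall>i. 0 \<le> e$i \<and> e$i \<le> N i} \<subseteq> vec_lambda ` (PiE UNIV (\<lambda>i. {0..N i}))"
  proof
    fix e :: "int^'n" assume "e \<in> {e. \<forall>i. 0 \<le> e$i \<and> e$i \<le> N i}"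
    then have "vec_nth e \<in> PiE UNIV (\<lambda>i. {0..N i})" by auto
    then show "e \<in> vec_lambda ` (PiE UNIV (\<lambda>i. {0..N i}))" by (metis imageI vec_nth_inverse)
  qed
  then show ?thesis by (rule finite_subset) (intro finite_imageI finite_PiE finite_class.finite_UNIV finite_atLeastAtMost_int)
qed

text \<open>Needed because a sum over an infinite index set would be \<open>0\<close>; dimension vectors of subobjects are
  bounded by that of \<open>V\<close>.\<close>

lemma finite_quiver_grassmannian_support:
  assumes rep: "is_valued_rep B D L K V \<phi>"
  shows "finite {e. quiver_grassmannian B D L K V \<phi> e \<noteq> {}}"
proof -
  have "{e. quiver_grassmannian B D L K V \<phi> e \<noteq> {}}
    \<subseteq> {e. \<forall>i. 0 \<le> e$i \<and> e$i \<le> dim_vector D L K V $ i}"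
  proof
    fix e assume "e \<in> {e. quiver_grassmannian B D L K V \<phi> e \<noteq> {}}"
    then obtain W where W: "W \<in> quiver_grassmannian B D L K V \<phi> e" by blast
    have e: "e = dim_vector D L K (\<lambda>i. (V i)\<lparr>carrier := W i\<rparr>)"
      using W by (simp add: quiver_grassmannian_def)
    have "VectorSpace.subspace (degree_extension L K (D i)) (W i) (V i)" for i
      using W by (simp add: quiver_grassmannian_def)
    from vectorspace.subspace_dim_le[OF valued_rep_vectorspace[OF rep] this]
    show "e \<in> {e. \<forall>i. 0 \<le> e$i \<and> e$i \<le> dim_vector D L K V $ i}"
      unfolding e by (simp add: dim_vector_def)
  qed
  then show ?thesis by (rule finite_subset) (rule finite_bounded_vectors)
qed

section \<open>The Euler form\<close>

lemma euler_form_row: "euler_form B D a b = (\<Sum>i\<in>UNIV. a$i * euler_form B D (axis i 1) b)"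
proof -
  have row: "euler_form B D (axis i 1) b
      = (\<Sum>j\<in>UNIV. b$j * (if i = j then int (D i) else - max 0 (int (D i) * B$i$j)))" for i
  proof -
    have "euler_form B D (axis i 1) b = (\<Sum>i'\<in>UNIV. if i' = i then
        (\<Sum>j\<in>UNIV. b$j * (if i' = j then int (D i') else - max 0 (int (D i') * B$i'$j))) else 0)"
      unfolding euler_form_def by (intro sum.cong refl) (simp add: axis_def)
    then show ?thesis by simp
  qed
  show ?thesis unfolding row unfolding euler_form_def by (simp add: sum_distrib_left mult.assoc)
qed

lemma euler_form_diff_right: "euler_form B D a (b - c) = euler_form B D a b - euler_form B D a c"
  by (simp add: euler_form_def left_diff_distrib right_diff_distrib sum_subtractf)

text \<open>\<open>\<langle>\<alpha>\<^sub>i, v\<rangle>\<close> is divisible by \<open>d\<^sub>i\<close> because \<open>max 0 (d\<^sub>i b\<^sub>i\<^sub>j) = d\<^sub>i max 0 b\<^sub>i\<^sub>j\<close>.\<close>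

lemma left_dual_exact:
  assumes "D i > 0"
  shows "int (D i) * left_dual B D v $ i = euler_form B D (axis i 1) v"
proof -
  have "int (D i) dvd euler_form B D a v" if "\<And>l. l \<noteq> i \<Longrightarrow> a$l = 0" for a
    unfolding euler_form_def
  proof (intro dvd_sum)
    fix l j
    show "int (D i) dvd a$l * v$j * (if l = j then int (D l) else - max 0 (int (D l) * B$l$j))"
    proof (cases "l = i")
      case True
      have "max 0 (int (D i) * B$i$j) = int (D i) * max 0 (B$i$j)"
        using assms by (simp add: max_def zero_le_mult_iff mult_le_0_iff)
      then show ?thesis using True by simp
    qed (simp add: that)
  qed
  then have "int (D i) dvd euler_form B D (axis i 1) v" by (simp add: axis_def)
  then show ?thesis by (simp add: left_dual_def)
qed

text \<open>The Euler form is recovered from \<open>\<Lambda>\<close>: pairing with \<open>B e\<close> weights the coordinates of \<open>\<^sup>*v\<close> by \<open>d\<^sub>l e\<^sub>l\<close>,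
  which undoes the division in its definition.\<close>

lemma lattice_form_left_dual:
  assumes "compatible_pair M B D"
  shows "lattice_form M (left_dual B D v) (B *v e) = - of_int (euler_form B D e v)"
proof -
  have "(\<Sum>l\<in>UNIV. left_dual B D v $ l * int (D l) * e$l) = (\<Sum>l\<in>UNIV. e$l * euler_form B D (axis l 1) v)"
    by (intro sum.cong refl)
      (simp only: left_dual_exact[OF compatible_pair_pos[OF assms], symmetric] mult_ac)
  then show ?thesis by (simp only: lattice_form_matrix_vector_mult[OF assms] euler_form_row[of B D e v])
qed

section \<open>Cluster characters\<close>

context quantum_torus_field
begin

abbreviation torus :: "'f set" where "torus \<equiv> \<iota> ` carrier (quantum_torus qp L)"

lemma eval_torus: "p \<in> carrier A \<Longrightarrow> eval p \<in> torus"
  unfolding eval_def using ring_hom_closed[OF torus_class_hom] by blast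

lemma torus_eq: "torus = eval ` carrier A"
proof -
  have "carrier (quantum_torus qp L) = torus_class qp L ` carrier A"
    unfolding quantum_torus_def FactRing_def torus_class_def A_RCOSETS_def' by auto
  then show ?thesis by (auto simp: eval_def)
qed

lemma torus_add:
  assumes "x \<in> torus" "y \<in> torus"
  shows "x + y \<in> torus"
proof -
  obtain p p' where p: "p \<in> carrier A" "p' \<in> carrier A" and xy: "x = eval p" "y = eval p'"
    using assms unfolding torus_eq by blast
  have "p + p' \<in> carrier A"
    using ring.ring_simprules(1)[OF ring_free_algebra p] by (simp only: free_algebra_simps(5))
  then have "eval (p + p') \<in> torus" by (rule eval_torus)
  then show ?thesis by (simp only: eval_add[OF p] xy)
qed

lemma torus_mult:
  assumes "x \<in> torus" "y \<in> torus"
  shows "x * y \<in> torus"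
proof -
  obtain p p' where p: "p \<in> carrier A" "p' \<in> carrier A" and xy: "x = eval p" "y = eval p'"
    using assms unfolding torus_eq by blast
  have "p * p' \<in> carrier A"
    using ring.ring_simprules(5)[OF ring_free_algebra p] by (simp only: free_algebra_simps(2))
  then have "eval (p * p') \<in> torus" by (rule eval_torus)
  then show ?thesis by (simp only: eval_mult[OF p] xy)
qed

lemma torus_scal: "r \<in> R \<Longrightarrow> scal r \<in> torus"
  unfolding scal_eval by (intro eval_torus single_carrier)

lemma torus_one: "1 \<in> torus"
  using torus_scal[OF base_ring_one] by (simp only: scal_one)

lemma torus_zero: "0 \<in> torus"
  using eval_torus[of 0] by (simp add: eval_zero base_ring_zero)

lemma torus_of_nat: "of_nat m \<in> torus"
  by (induction m) (simp_all add: torus_zero torus_one torus_add)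

lemma torus_power: "x \<in> torus \<Longrightarrow> x ^ m \<in> torus"
  by (induction m) (simp_all add: torus_one torus_mult)

lemma torus_sum: "(\<And>x. x \<in> S \<Longrightarrow> f x \<in> torus) \<Longrightarrow> sum f S \<in> torus"
  by (induction S rule: infinite_finite_induct) (auto intro: torus_zero torus_add)

lemma torus_gen_powi: "gen i powi m \<in> torus"
proof -
  have "gen i \<in> torus" "inverse (gen i) \<in> torus"
    unfolding genInv_eval[symmetric] unfolding gen_eval by (intro eval_torus single_carrier base_ring_one)+
  then show ?thesis by (simp add: power_int_def torus_power)
qed

lemma torus_monomial: "monomial a \<in> torus"
proof -
  have "prod_list (map (\<lambda>i. gen i powi (a$i)) xs) \<in> torus" for xs
    by (induction xs) (simp_all add: torus_one torus_mult torus_gen_powi)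
  then show ?thesis
    unfolding torus_monomial_def
    by (intro torus_mult torus_scal base_ring_exponent[OF powers norm_exponent_in])
qed

end

lemma rational_powers_real: "q > 0 \<Longrightarrow> rational_powers q (real_rational_power q)"
  by (simp add: rational_powers_def real_rational_power_def of_rat_add powr_add)

context DB_embedding
begin

text \<open>Splitting \<open>X^(B e - \<^sup>*v)\<close> costs \<open>q^(\<langle>e, v\<rangle> / 2)\<close>, which turns the coefficient \<open>q^(- \<langle>e, v - e\<rangle> / 2)\<close> into
  \<open>q^(\<langle>e, e\<rangle> / 2)\<close>.\<close>

lemma cluster_character_term:
  "X.scal (qp (- (1/2) * of_int (euler_form B D e (v - e)))) * of_nat m * X.monomial (B *v e - left_dual B D v)
    = j (Z.scal (qp (1/2 * of_int (euler_form B D e e))) * of_nat m * Z.monomial e) * X.monomial (- left_dual B D v)"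
proof -
  let ?g = "- left_dual B D v"
  let ?r = "- of_int (euler_form B D e v) / 2 :: rat"
  let ?s = "- of_int (euler_form B D e (v - e)) / 2 :: rat"
  let ?t = "of_int (euler_form B D e e) / 2 :: rat"
  have half: "- of_int m / 2 \<in> half_exponents M" for m and M :: "rat^'n::{finite,linorder}^'n::{finite,linorder}"
    using half_exponents_half_int[of "- m"] by simp
  have r: "?r \<in> half_exponents (Lambda_matrix B D)" and s: "?s \<in> half_exponents (Lambda_matrix B D)"
    by (rule half)+
  have t: "?t \<in> half_exponents (DB_matrix B D)" "?t \<in> half_exponents (Lambda_matrix B D)"
    by (rule half_exponents_half_int)+
  have "lattice_form (Lambda_matrix B D) (B *v e) ?g = lattice_form (Lambda_matrix B D) (left_dual B D v) (B *v e)"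
    unfolding lattice_form_minus_right using lattice_form_swap[OF compatible_pair_skew[OF compat], of "B *v e" "left_dual B D v"]
    by simp
  then have lattice_form: "lattice_form (Lambda_matrix B D) (B *v e) ?g / 2 = ?r"
    unfolding lattice_form_left_dual[OF compat] by simp
  have "?t + ?r = ?s" by (simp add: euler_form_diff_right diff_divide_distrib)
  then have "X.qscal ?s = X.qscal ?t * X.qscal ?r" using X.qscal_add[OF t(2) r] by simp
  then have "X.qscal ?s * of_nat m * X.monomial (B *v e - left_dual B D v)
      = X.qscal ?t * (X.qscal ?r * of_nat m) * X.monomial (B *v e + ?g)"
    by (simp add: mult.assoc)
  also have "\<dots> = X.qscal ?t * of_nat m * (X.qscal ?r * X.monomial (B *v e + ?g))"
    by (simp only: X.qscal_central[OF r, of "of_nat m"] mult.assoc)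
  also have "X.qscal ?r * X.monomial (B *v e + ?g) = X.monomial (B *v e) * X.monomial ?g"
    by (simp only: X.monomial_mult lattice_form)
  also have "X.qscal ?t * of_nat m * (X.monomial (B *v e) * X.monomial ?g) = j (Z.qscal ?t * of_nat m * Z.monomial e) * X.monomial ?g"
    by (simp only: j_hom j_qscal[OF t(1)] j_monomial mult.assoc)
  finally show ?thesis by simp
qed

end

lemma cluster_character_factorisation:
  fixes B :: "int^'n::{finite,linorder}^'n::{finite,linorder}"
    and \<iota> :: "('n, real, 'f::division_ring) torus_map" and \<iota>Z :: "('n, real, 'g::division_ring) torus_map"
  assumes emb: "DB_embedding q qp B D \<iota> \<iota>Z j" and qp: "qp = real_rational_power (real (card K))"
    and rep: "is_valued_rep B D L K V \<phi>"
  shows "cluster_character B D L K V \<phi> \<iota>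
      = j (F_polynomial B D L K V \<phi> \<iota>Z) * torus_monomial qp (Lambda_matrix B D) \<iota> (- left_dual B D (dim_vector D L K V))"
proof -
  interpret DB_embedding q qp B D \<iota> \<iota>Z j by (rule emb)
  let ?v = "dim_vector D L K V"
  let ?Gr = "quiver_grassmannian B D L K V \<phi>"
  let ?S = "{e. ?Gr e \<noteq> {}}"
  define f where "f e = Z.scal (qp (1/2 * of_int (euler_form B D e e))) * of_nat (card (?Gr e)) * Z.monomial e" for e
  have fin: "finite ?S" by (rule finite_quiver_grassmannian_support[OF rep])
  have z: "0 \<in> ?S" by (simp add: quiver_grassmannian_zero[OF rep])
  have f0: "f 0 = 1"
    by (simp add: f_def quiver_grassmannian_zero[OF rep] euler_form_def)
  have F: "F_polynomial B D L K V \<phi> \<iota>Z = (\<Sum>e\<in>?S. f e)"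
  proof -
    have nonzero: "{e. e \<noteq> 0 \<and> ?Gr e \<noteq> {}} = ?S - {0}" by auto
    have "F_polynomial B D L K V \<phi> \<iota>Z = 1 + (\<Sum>e\<in>?S - {0}. f e)"
      unfolding F_polynomial_def Let_def qp[symmetric] nonzero f_def ..
    also have "\<dots> = (\<Sum>e\<in>?S. f e)" unfolding sum.remove[OF fin z] f0 ..
    finally show ?thesis .
  qed
  have j_sum: "j (\<Sum>e\<in>S. f e) = (\<Sum>e\<in>S. j (f e))" for S
    by (induction S rule: infinite_finite_induct) (simp_all add: j_hom)
  have "cluster_character B D L K V \<phi> \<iota> = (\<Sum>e\<in>?S. j (f e) * X.monomial (- left_dual B D ?v))"
    unfolding cluster_character_def Let_def qp[symmetric] cluster_character_term f_def ..
  then show ?thesis unfolding F j_sum sum_distrib_right .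
qed

lemma cluster_character_in_torus:
  fixes B :: "int^'n::{finite,linorder}^'n::{finite,linorder}"
    and \<iota> :: "('n, real, 'f::division_ring) torus_map"
  assumes torus: "quantum_torus_field q qp (Lambda_matrix B D) \<iota>"
    and qp: "qp = real_rational_power (real (card K))"
  shows "cluster_character B D L K V \<phi> \<iota> \<in> \<iota> ` carrier (quantum_torus qp (Lambda_matrix B D))"
proof -
  interpret quantum_torus_field q qp "Lambda_matrix B D" \<iota> by (rule torus)
  have half: "- (1/2) * of_int m \<in> half_exponents (Lambda_matrix B D)" for m
    using half_exponents_half_int[of "- m"] by simp
  show ?thesis
    unfolding cluster_character_def Let_def qp[symmetric]
    by (intro torus_sum torus_mult torus_scal torus_of_nat torus_monomial base_ring_exponent[OF powers half])
qed

theorem proposition1p6: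
  fixes B :: "int^'n::{finite,linorder}^'n::{finite,linorder}" and D :: "'n \<Rightarrow> nat"
  assumes "invertible_valued_quiver B D"
  shows
    "(\<forall>(k::'n) (q::'k::field_char_0) (qp::rat \<Rightarrow> 'k)
        (\<iota>::('n, 'k, 'f::division_ring) torus_map) (\<iota>'::('n, 'k, 'f'::division_ring) torus_map)
        (\<iota>Z::('n, 'k, 'g::division_ring) torus_map) (\<iota>Z'::('n, 'k, 'g'::division_ring) torus_map)
        j j' \<mu> x.
        rational_powers q qp \<longrightarrow>
        is_skew_fraction_field (quantum_torus qp (Lambda_matrix B D)) \<iota> \<longrightarrow>
        is_skew_fraction_field (quantum_torus qp (Lambda_matrix (mutate_matrix k B) D)) \<iota>' \<longrightarrow>
        is_skew_fraction_field (quantum_torus qp (DB_matrix B D)) \<iota>Z \<longrightarrow>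
        is_skew_fraction_field (quantum_torus qp (DB_matrix (mutate_matrix k B) D)) \<iota>Z' \<longrightarrow>
        is_DB_embedding qp B D \<iota>Z \<iota> j \<longrightarrow>
        is_DB_embedding qp (mutate_matrix k B) D \<iota>Z' \<iota>' j' \<longrightarrow>
        is_mutation qp B D k \<iota> \<iota>' \<mu> \<longrightarrow>
        B_compatible qp B D \<iota> j x \<longrightarrow>
        B_compatible qp (mutate_matrix k B) D \<iota>' j' (\<mu> x))
     \<and>
     (\<forall>(L::'c ring) K V (\<phi>::'n \<Rightarrow> 'n \<Rightarrow> nat \<Rightarrow> 'v \<Rightarrow> 'v) qp
        (\<iota>::('n, real, 'h::division_ring) torus_map) (\<iota>Z::('n, real, 'l::division_ring) torus_map) j.
        algebraic_closure L K \<longrightarrow> finite K \<longrightarrow>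
        is_valued_rep B D L K V \<phi> \<longrightarrow>
        qp = real_rational_power (real (card K)) \<longrightarrow>
        is_skew_fraction_field (quantum_torus qp (Lambda_matrix B D)) \<iota> \<longrightarrow>
        is_skew_fraction_field (quantum_torus qp (DB_matrix B D)) \<iota>Z \<longrightarrow>
        is_DB_embedding qp B D \<iota>Z \<iota> j \<longrightarrow>
        cluster_character B D L K V \<phi> \<iota> \<in> \<iota> ` carrier (quantum_torus qp (Lambda_matrix B D)) \<and>
        B_compatible qp B D \<iota> j (cluster_character B D L K V \<phi> \<iota>) \<and>
        is_F_factor qp B D \<iota> j (F_polynomial B D L K V \<phi> \<iota>Z) (cluster_character B D L K V \<phi> \<iota>))"
proof (rule conjI, goal_cases)
  case 1
  show ?case
  proof (intro allI impI, goal_cases)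
    case (1 k q qp \<iota> \<iota>' \<iota>Z \<iota>Z' j j' \<mu> x)
    note compat = compatible_pair_Lambda[OF assms]
    have "DB_embedding q qp B D \<iota> \<iota>Z j"
      by (rule DB_embedding.intro) (rule 1 compat)+
    moreover have "DB_embedding q qp (mutate_matrix k B) D \<iota>' \<iota>Z' j'"
      by (rule DB_embedding.intro) (rule 1 compatible_pair_mutate[OF compat])+
    ultimately have "mutation q qp B D \<iota> \<iota>Z j k \<iota>' \<iota>Z' j' \<mu>"
      by (rule mutation.intro) (rule mutation_axioms.intro, rule 1)
    then show ?case using 1(9) by (rule mutation.mutation_preserves_compatibility)
  qed
next
  case 2
  show ?case
  proof (intro allI impI, goal_cases)
    case (1 L K V \<phi> qp \<iota> \<iota>Z j)
    interpret algebraic_closure L K by (rule 1(1))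
    have "card K > 0"
      using 1(2) subringE(4)[OF subring_axioms] by (simp add: card_gt_0_iff)
    then have "rational_powers (real (card K)) qp"
      unfolding 1(4) by (intro rational_powers_real) simp
    then have emb: "DB_embedding (real (card K)) qp B D \<iota> \<iota>Z j"
      by (rule DB_embedding.intro) (rule 1 compatible_pair_Lambda[OF assms])+
    have "is_F_factor qp B D \<iota> j (F_polynomial B D L K V \<phi> \<iota>Z) (cluster_character B D L K V \<phi> \<iota>)"
      unfolding is_F_factor_def using cluster_character_factorisation[OF emb 1(4) 1(3)] by blast
    moreover have "cluster_character B D L K V \<phi> \<iota> \<in> \<iota> ` carrier (quantum_torus qp (Lambda_matrix B D))"
    proof -
      interpret E: DB_embedding "real (card K)" qp B D \<iota> \<iota>Z j by (rule emb)
      show ?thesis by (rule cluster_character_in_torus[OF E.X.quantum_torus_field_axioms 1(4)])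
    qed
    ultimately show ?case unfolding B_compatible_def by blast
  qed
qed

end
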